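(* Let $a,b:(0,\infty)\to(0,1)$ be Borel-measurable functions with $0<b(x)<a(x)<1$ for all $x>0$ and $0<\liminf_{x\to\infty}a(x)\le\limsup_{x\to\infty}a(x)<1$. For $x>0$, let $S=(S_k)_{k\in\mathbb{N}_0}$ be under $\mathbb{P}_x$ the positive Markov martingale started from $S_0=x$ with transition kernel $$K(x,\mathrm{d}y)=a(x)\,\delta_{\frac{b(x)x}{a(x)}}(\mathrm{d}y)+(1-a(x))\,\delta_{\frac{(1-b(x))x}{1-a(x)}}(\mathrm{d}y).$$ Suppose moreover that there exists $x_b>0$ such that $b$ is nonincreasing on $[x_b,\infty)$. Then, for $x>0$, $S$ is a bubble under $\mathbb{P}_x$ if and only if $S$ is not $\mathbb{P}_x$-a.s. bounded and $\int_{\log(x_b)}^\infty b(\exp(u))\,\mathrm{d}u<\infty$.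
   Context: $\delta_z$ denotes the Dirac measure at $z$. For $x>0$, under $\mathbb{P}_x$ (with expectation $\mathbb{E}_x$) the process $S=(S_k)_{k\in\mathbb{N}_0}$ is the time-homogeneous Markov chain on $(0,\infty)$ with $S_0=x$ and transition kernel $K$; it is a positive martingale (since $\int y\,K(x,\mathrm{d}y)=x$), with $\mathbb{P}_x$-a.s. limit $S_\infty$. "$S$ is $\mathbb{P}_x$-a.s. bounded" means that there is a deterministic constant $C<\infty$ with $\mathbb{P}_x[S_k\le C \text{ for all } k\in\mathbb{N}_0]=1$. Definition (bubble): put $\tau_0:=0$ and $\tau_k:=\inf\{j>\tau_{k-1}: S_j<S_{j-1}\}$ for $k\in\mathbb{N}$ ($\inf\emptyset=\infty$), and $S_{\tau_k}:=S_\infty$ on $\{\tau_k=\infty\}$. $S$ is a bubble under $\mathbb{P}_x$ (equivalently $\mathbb{P}_x$ is a bubble measure for $S$) if $\mathbb{E}_x[S_{\tau_k}]<\mathbb{E}_x[S_0]=x$ for some $k\in\mathbb{N}$. *)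

theory Defs
  imports "HOL-Probability.Probability"
begin

definition pos_borel :: "real measure" where
  "pos_borel = restrict_space borel {0<..}"

definition natural_filtration :: "'w measure \<Rightarrow> 's measure \<Rightarrow> (nat \<Rightarrow> 'w \<Rightarrow> 's) \<Rightarrow> nat \<Rightarrow> 'w measure" where
  "natural_filtration M E S n =
     sigma (space M) (\<Union>k\<in>{..n}. {S k -` A \<inter> space M |A. A \<in> sets E})"

(* The measure M plays the role of the law P_x: started in x, and
   P_x[S_(n+1) \<in> A | S_0, ..., S_n] = K (S_n, A) almost surely. *)
definition markov_chain_from ::
  "'w measure \<Rightarrow> 's measure \<Rightarrow> ('s \<Rightarrow> 's measure) \<Rightarrow> 's \<Rightarrow> (nat \<Rightarrow> 'w \<Rightarrow> 's) \<Rightarrow> bool" where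
  "markov_chain_from M E K x S \<longleftrightarrow>
     prob_space M \<and>
     (\<forall>n. S n \<in> measurable M E) \<and>
     (AE \<omega> in M. S 0 \<omega> = x) \<and>
     (\<forall>n. \<forall>A\<in>sets E. AE \<omega> in M.
        real_cond_exp M (natural_filtration M E S n) (\<lambda>\<omega>. indicator A (S (Suc n) \<omega>)) \<omega>
          = measure (K (S n \<omega>)) A)"

definition two_point_kernel :: "(real \<Rightarrow> real) \<Rightarrow> (real \<Rightarrow> real) \<Rightarrow> real \<Rightarrow> real measure" where
  "two_point_kernel a b x = measure_of (space pos_borel) (sets pos_borel)
     (\<lambda>A. ennreal (a x) * emeasure (return pos_borel (b x * x / a x)) A
        + ennreal (1 - a x) * emeasure (return pos_borel ((1 - b x) * x / (1 - a x))) A)"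

lemma space_pos_borel: "space pos_borel = {0<..}"
  by (simp add: pos_borel_def space_restrict_space)

lemma sets_two_point_kernel: "sets (two_point_kernel a b x) = sets pos_borel"
  unfolding two_point_kernel_def by simp

lemma emeasure_two_point_kernel:
  assumes "A \<in> sets pos_borel"
  shows "emeasure (two_point_kernel a b x) A =
    ennreal (a x) * emeasure (return pos_borel (b x * x / a x)) A
    + ennreal (1 - a x) * emeasure (return pos_borel ((1 - b x) * x / (1 - a x))) A"
  unfolding two_point_kernel_def
proof (rule emeasure_measure_of_sigma)
  show "sigma_algebra (space pos_borel) (sets pos_borel)"
    by (rule sets.sigma_algebra_axioms)
  show "positive (sets pos_borel)
     (\<lambda>A. ennreal (a x) * emeasure (return pos_borel (b x * x / a x)) A
        + ennreal (1 - a x) * emeasure (return pos_borel ((1 - b x) * x / (1 - a x))) A)"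
    by (simp add: positive_def)
  show "countably_additive (sets pos_borel)
     (\<lambda>A. ennreal (a x) * emeasure (return pos_borel (b x * x / a x)) A
        + ennreal (1 - a x) * emeasure (return pos_borel ((1 - b x) * x / (1 - a x))) A)"
  proof (rule countably_additiveI)
    fix F :: "nat \<Rightarrow> real set"
    assume F: "range F \<subseteq> sets pos_borel" "disjoint_family F" "\<Union> (range F) \<in> sets pos_borel"
    have "(\<Sum>i. emeasure (return pos_borel z) (F i)) = emeasure (return pos_borel z) (\<Union> (range F))" for z
      using F(1,2) by (intro suminf_emeasure) auto
    then show "(\<Sum>i. ennreal (a x) * emeasure (return pos_borel (b x * x / a x)) (F i)
        + ennreal (1 - a x) * emeasure (return pos_borel ((1 - b x) * x / (1 - a x))) (F i))
      = ennreal (a x) * emeasure (return pos_borel (b x * x / a x)) (\<Union> (range F))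
        + ennreal (1 - a x) * emeasure (return pos_borel ((1 - b x) * x / (1 - a x))) (\<Union> (range F))"
      by (subst suminf_add[symmetric]) (simp_all only: ennreal_suminf_cmult summableI)
  qed
qed (rule assms)

lemma prob_space_two_point_kernel:
  assumes "0 < x" "0 < b x" "b x < a x" "a x < 1"
  shows "prob_space (two_point_kernel a b x)"
proof (rule prob_spaceI)
  have sp: "space (two_point_kernel a b x) = space pos_borel"
    by (rule sets_eq_imp_space_eq[OF sets_two_point_kernel])
  have [simp]: "{0<..} \<in> sets pos_borel"
    using sets.top[of pos_borel] by (simp only: space_pos_borel)
  have "b x * x / a x \<in> {0<..}" "(1 - b x) * x / (1 - a x) \<in> {0<..}"
    using assms by auto
  then show "emeasure (two_point_kernel a b x) (space (two_point_kernel a b x)) = 1"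
    unfolding sp using assms
    by (subst emeasure_two_point_kernel)
       (simp_all add: space_pos_borel emeasure_return flip: ennreal_plus)
qed

lemma subalgebra_natural_filtration:
  assumes "\<And>k. S k \<in> measurable M E"
  shows "subalgebra M (natural_filtration M E S n)"
proof -
  have "(\<Union>k\<in>{..n}. {S k -` A \<inter> space M |A. A \<in> sets E}) \<subseteq> sets M"
    using assms by (auto intro: measurable_sets)
  then have "sigma_sets (space M) (\<Union>k\<in>{..n}. {S k -` A \<inter> space M |A. A \<in> sets E}) \<subseteq> sets M"
    by (rule sets.sigma_sets_subset)
  moreover have "(\<Union>k\<in>{..n}. {S k -` A \<inter> space M |A. A \<in> sets E}) \<subseteq> Pow (space M)"
    by auto
  ultimately show ?thesis
    unfolding subalgebra_def natural_filtration_def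
    by (simp only: space_measure_of sets_measure_of simp_thms)
qed

definition as_bounded :: "'w measure \<Rightarrow> (nat \<Rightarrow> 'w \<Rightarrow> real) \<Rightarrow> bool" where
  "as_bounded M S \<longleftrightarrow> (\<exists>C::real. AE \<omega> in M. \<forall>k. S k \<omega> \<le> C)"

(* The infimum is taken in enat, where Inf {} = \<infinity>. *)
fun drop_time :: "(nat \<Rightarrow> 'w \<Rightarrow> real) \<Rightarrow> nat \<Rightarrow> 'w \<Rightarrow> enat" where
  "drop_time S 0 \<omega> = 0"
| "drop_time S (Suc k) \<omega> = Inf {enat j |j. enat j > drop_time S k \<omega> \<and> S j \<omega> < S (j - 1) \<omega>}"

definition limit_value :: "(nat \<Rightarrow> 'w \<Rightarrow> real) \<Rightarrow> 'w \<Rightarrow> real" where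
  "limit_value S \<omega> = lim (\<lambda>n. S n \<omega>)"

definition value_at :: "(nat \<Rightarrow> 'w \<Rightarrow> real) \<Rightarrow> enat \<Rightarrow> 'w \<Rightarrow> real" where
  "value_at S t \<omega> = (case t of enat n \<Rightarrow> S n \<omega> | \<infinity> \<Rightarrow> limit_value S \<omega>)"

(* S is a positive process, so its expectations are taken as integrals with values in [0, \<infinity>]:
   no integrability has to be presupposed, unlike with the Bochner integral, which is 0 on
   non-integrable functions. *)
definition bubble :: "'w measure \<Rightarrow> (nat \<Rightarrow> 'w \<Rightarrow> real) \<Rightarrow> bool" where
  "bubble M S \<longleftrightarrow> (\<exists>k\<ge>1.
     (\<integral>\<^sup>+\<omega>. ennreal (value_at S (drop_time S k \<omega>) \<omega>) \<partial>M) < (\<integral>\<^sup>+\<omega>. ennreal (S 0 \<omega>) \<partial>M))"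

end

theory Submission
  imports Defs
begin

text \<open>At the time of the \<open>k\<close>-th drop let the chain be in \<open>z\<close>, and let
  \<open>z\<^sub>0 = z, z\<^sub>1, z\<^sub>2, \<dots>\<close> be the states that it visits while it goes up. The drop out of \<open>z\<^sub>n\<close>
  contributes \<open>z \<cdot> b(z\<^sub>n) \<cdot> \<Prod>i<n. (1 - b(z\<^sub>i))\<close> to the expectation of the value at the next drop.
  The sum over \<open>n\<close> telescopes to \<open>z (1 - \<pi>)\<close> with \<open>\<pi> = \<Prod>i. (1 - b(z\<^sub>i))\<close>. If \<open>z\<^sub>n\<close> converges, the
  missing \<open>z \<pi>\<close> is the contribution of the event that there is no further drop; if \<open>z\<^sub>n\<close> tends to
  infinity, that event is null and \<open>z \<pi>\<close> is lost. Hence the chain is a bubble iff from some state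
  reached at a drop time (or the start) the upward path explodes with \<open>\<Sum>n. b(z\<^sub>n) < \<infinity>\<close>. Far out,
  \<open>ln z\<^sub>n\<close> grows by bounded steps, which are also bounded away from 0 once \<open>b\<close> is small, so
  by monotonicity of \<open>b\<close> this sum is finite iff the integral is; and once
  \<open>b\<close> tends to 0, every upward path that gets far enough explodes.\<close>

section \<open>Drop times\<close>

text \<open>A nonempty set of extended naturals attains its infimum, which turns the infimum in
  \<open>drop_time\<close> into a first-time statement.\<close>

lemma Inf_enat_eq_enat_iff: "Inf {enat j |j. P j} = enat n \<longleftrightarrow> P n \<and> (\<forall>j<n. \<not> P j)"
proof
  assume eq: "Inf {enat j |j. P j} = enat n"
  then have ne: "{enat j |j. P j} \<noteq> {}"
    by (auto simp only: Inf_enat_def simp_thms if_True)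
  have "Inf {enat j |j. P j} \<in> {enat j |j. P j}"
    using ne unfolding Inf_enat_def by (metis (no_types, lifting) LeastI ex_in_conv)
  moreover have "\<not> P j" if "j < n" for j
  proof
    assume "P j"
    then have "Inf {enat j |j. P j} \<le> enat j"
      by (intro Inf_lower) auto
    with eq that show False by simp
  qed
  ultimately show "P n \<and> (\<forall>j<n. \<not> P j)"
    using eq by auto
next
  assume "P n \<and> (\<forall>j<n. \<not> P j)"
  then show "Inf {enat j |j. P j} = enat n"
    by (intro antisym Inf_lower Inf_greatest) (auto simp: not_less[symmetric])
qed

lemma Inf_enat_eq_infinity_iff: "Inf {enat j |j. P j} = \<infinity> \<longleftrightarrow> (\<forall>j. \<not> P j)"
proof
  assume "Inf {enat j |j. P j} = \<infinity>"
  then have "\<infinity> \<le> enat j" if "P j" for j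
    using Inf_lower[of "enat j" "{enat j |j. P j}"] that by auto
  then show "\<forall>j. \<not> P j" by auto
next
  assume "\<forall>j. \<not> P j"
  then have "{enat j |j. P j} = {}" by auto
  then show "Inf {enat j |j. P j} = \<infinity>"
    by (simp only: Inf_enat_def simp_thms if_True)
qed

text \<open>In this form the event that the next drop occurs at time \<open>n\<close> is built from
  events up to time \<open>n\<close>. As \<open>n\<close> and \<open>j\<close> exceed
  \<open>m\<close>, the natural subtraction of 1 never truncates.\<close>

lemma drop_time_Suc_eq_enat_iff:
  "drop_time S (Suc k) \<omega> = enat n \<longleftrightarrow>
    (\<exists>m<n. drop_time S k \<omega> = enat m \<and> (\<forall>j\<in>{m<..<n}. \<not> S j \<omega> < S (j - 1) \<omega>)) \<and>
    S n \<omega> < S (n - 1) \<omega>"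
  unfolding drop_time.simps(2) Inf_enat_eq_enat_iff
  by (cases "drop_time S k \<omega>") auto

lemma drop_time_Suc_eq_infinity_iff:
  "drop_time S (Suc k) \<omega> = \<infinity> \<longleftrightarrow>
    (\<forall>m. drop_time S k \<omega> = enat m \<longrightarrow> (\<forall>j>m. \<not> S j \<omega> < S (j - 1) \<omega>))"
  unfolding drop_time.simps(2) Inf_enat_eq_infinity_iff
  by (cases "drop_time S k \<omega>") auto

declare drop_time.simps(2) [simp del]

section \<open>Upward paths\<close>

definition up :: "(real \<Rightarrow> real) \<Rightarrow> (real \<Rightarrow> real) \<Rightarrow> real \<Rightarrow> real" where
  "up a b y = (1 - b y) * y / (1 - a y)"

definition down :: "(real \<Rightarrow> real) \<Rightarrow> (real \<Rightarrow> real) \<Rightarrow> real \<Rightarrow> real" where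
  "down a b y = b y * y / a y"

lemma singleton_pos_borel: "q > 0 \<Longrightarrow> {q} \<in> sets pos_borel"
  by (auto simp: pos_borel_def sets_restrict_space_iff)

lemma sets_natural_filtration_generator:
  assumes "A \<in> sets E" "k \<le> n"
  shows "S k -` A \<inter> space M \<in> sets (natural_filtration M E S n)"
proof -
  have "S k -` A \<inter> space M \<in> (\<Union>k\<in>{..n}. {S k -` A \<inter> space M |A. A \<in> sets E})"
    using assms by blast
  moreover have "(\<Union>k\<in>{..n}. {S k -` A \<inter> space M |A. A \<in> sets E}) \<subseteq> Pow (space M)"
    by auto
  ultimately show ?thesis
    unfolding natural_filtration_def by (simp add: sets_measure_of sigma_sets.Basic)
qed

lemma space_natural_filtration [simp]: "space (natural_filtration M E S n) = space M"
  by (simp add: natural_filtration_def space_measure_of_conv)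

locale two_point_parameters =
  fixes a b :: "real \<Rightarrow> real"
  assumes ab: "y > 0 \<Longrightarrow> 0 < b y \<and> b y < a y \<and> a y < 1"
begin

lemma up_pos: "y > 0 \<Longrightarrow> up a b y > 0"
  using ab[of y] by (auto simp: up_def intro!: divide_pos_pos mult_pos_pos)

lemma down_pos: "y > 0 \<Longrightarrow> down a b y > 0"
  using ab[of y] by (auto simp: down_def intro!: divide_pos_pos mult_pos_pos)

lemma up_greater: "y > 0 \<Longrightarrow> y < up a b y"
  using ab[of y] by (auto simp: up_def field_simps)

lemma down_less: "y > 0 \<Longrightarrow> down a b y < y"
  using ab[of y] by (auto simp: down_def field_simps)

lemma measure_kernel:
  assumes "y > 0" "C \<in> sets pos_borel"
  shows "measure (two_point_kernel a b y) C
    = a y * indicator C (down a b y) + (1 - a y) * indicator C (up a b y)"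
proof -
  have "emeasure (two_point_kernel a b y) C
    = ennreal (a y * indicator C (down a b y) + (1 - a y) * indicator C (up a b y))"
    using ab[OF assms(1)] assms(2)
    by (subst emeasure_two_point_kernel)
      (auto simp: up_def down_def indicator_def simp flip: ennreal_plus)
  then show ?thesis
    using ab[OF assms(1)] by (intro measure_eq_emeasure_eq_ennreal) auto
qed

text \<open>This is the sequence \<open>z\<^sub>n\<close> of the overview.\<close>

definition ups :: "real \<Rightarrow> nat \<Rightarrow> real" where
  "ups z n = (up a b ^^ n) z"

lemma ups_0 [simp]: "ups z 0 = z"
  and ups_Suc: "ups z (Suc n) = up a b (ups z n)"
  by (simp_all add: ups_def)

lemma ups_add: "ups z (m + n) = ups (ups z m) n"
  by (simp add: ups_def add.commute[of m n] funpow_add)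

lemma ups_pos: "z > 0 \<Longrightarrow> ups z n > 0"
  by (induction n) (auto simp: ups_Suc up_pos)

lemma ups_strict_mono: "z > 0 \<Longrightarrow> strict_mono (ups z)"
  by (simp add: strict_mono_Suc_iff ups_Suc up_greater ups_pos)

lemma ups_mono: "z > 0 \<Longrightarrow> m \<le> n \<Longrightarrow> ups z m \<le> ups z n"
  using ups_strict_mono[of z] by (simp add: strict_mono_less_eq)

lemma ups_at_top:
  assumes "z > 0" "\<not> bdd_above (range (ups z))"
  shows "filterlim (ups z) at_top sequentially"
  unfolding filterlim_at_top
proof
  fix Z
  obtain n where "Z < ups z n"
    using assms(2) by (metis bdd_aboveI2 not_le)
  then show "\<forall>\<^sub>F n in sequentially. Z \<le> ups z n"
    unfolding eventually_sequentially using ups_mono[OF assms(1)] by (meson less_imp_le order_trans)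
qed

text \<open>The fraction of the expectation at \<open>z\<close> that is still on the upward path
  after \<open>n\<close> steps.\<close>

definition keep :: "real \<Rightarrow> nat \<Rightarrow> real" where
  "keep z n = (\<Prod>i<n. 1 - b (ups z i))"

lemma keep_simps: "keep z 0 = 1" "keep z (Suc n) = keep z n * (1 - b (ups z n))"
  by (simp_all add: keep_def)

lemma b_bounds: "y > 0 \<Longrightarrow> 0 < b y \<and> b y < 1"
  using ab[of y] by simp

lemma keep_pos: "z > 0 \<Longrightarrow> keep z n > 0"
  unfolding keep_def using b_bounds ups_pos by (intro prod_pos) auto

lemma decseq_keep: "z > 0 \<Longrightarrow> decseq (keep z)"
  using b_bounds[OF ups_pos[of z]] keep_pos[of z]
  by (intro decseq_SucI) (auto simp: keep_simps intro!: mult_left_le less_imp_le)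

lemma keep_le_1: "z > 0 \<Longrightarrow> keep z n \<le> 1"
  using decseqD[OF decseq_keep, of z 0 n] by (simp add: keep_simps)

text \<open>The number \<open>\<pi>\<close> of the overview. For \<open>z > 0\<close> the limit
  exists because \<open>keep z\<close> is decreasing and positive.\<close>

definition keep_lim :: "real \<Rightarrow> real" where
  "keep_lim z = lim (keep z)"

lemma keep_tendsto: "z > 0 \<Longrightarrow> keep z \<longlonglongrightarrow> keep_lim z"
  unfolding keep_lim_def
  using decseq_convergent[OF decseq_keep, of z 0] keep_pos[of z]
  by (metis convergent_LIMSEQ_iff convergent_def less_imp_le)

lemma keep_lim_bounds:
  assumes "z > 0" shows "0 \<le> keep_lim z" "keep_lim z \<le> 1"
  using LIMSEQ_le_const[OF keep_tendsto[OF assms], of 0] LIMSEQ_le_const2[OF keep_tendsto[OF assms], of 1]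
    keep_pos[OF assms] keep_le_1[OF assms] by (auto intro: less_imp_le)

text \<open>One step up from \<open>y\<close> multiplies the probability by \<open>1 - a y\<close> and the value by
  \<open>(1 - b y) / (1 - a y)\<close>; so \<open>1 - b y\<close> is the fraction of the expectation that goes up.\<close>

lemma ups_times_prob: "z > 0 \<Longrightarrow> ups z n * (\<Prod>i<n. 1 - a (ups z i)) = z * keep z n"
proof (induction n)
  case (Suc n)
  have "1 - a (ups z n) > 0"
    using ab[OF ups_pos[OF Suc.prems, of n]] by simp
  then have "ups z (Suc n) * (\<Prod>i<Suc n. 1 - a (ups z i))
      = (1 - b (ups z n)) * (ups z n * (\<Prod>i<n. 1 - a (ups z i)))"
    by (simp add: ups_Suc up_def)
  with Suc show ?case by (simp add: keep_simps)
qed (simp add: keep_simps)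

text \<open>Since each layer is finite, almost sure statements can be proved state by state and then
  combined.\<close>

primrec layer :: "real \<Rightarrow> nat \<Rightarrow> real set" where
  "layer x 0 = {x}"
| "layer x (Suc n) = up a b ` layer x n \<union> down a b ` layer x n"

lemma finite_layer: "finite (layer x n)"
  by (induction n) auto

lemma layer_pos: "x > 0 \<Longrightarrow> y \<in> layer x n \<Longrightarrow> y > 0"
  by (induction n arbitrary: y) (auto simp: up_pos down_pos)

end

section \<open>Exploding upward paths and the integral of \<open>b\<close>\<close>

locale two_point_tail = two_point_parameters +
  fixes x\<^sub>b :: real
  assumes b_meas: "b \<in> borel_measurable pos_borel"
    and liminf_a: "0 < Liminf at_top (\<lambda>y. ereal (a y))"
    and limsup_a: "Limsup at_top (\<lambda>y. ereal (a y)) < 1"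
    and xb_pos: "x\<^sub>b > 0"
    and b_antimono: "antimono_on {x\<^sub>b..} b"
begin

text \<open>The conditions on the limits of \<open>a\<close> at infinity, condensed into one
  constant that keeps \<open>a\<close> away from both 0 and 1 far out.\<close>

lemma a_tail_bounds:
  obtains \<epsilon> Y where "0 < \<epsilon>" "\<epsilon> < 1" "x\<^sub>b \<le> Y" "\<And>y. y \<ge> Y \<Longrightarrow> \<epsilon> \<le> a y \<and> a y \<le> 1 - \<epsilon>"
proof -
  obtain l where l: "0 < ereal l" "ereal l < Liminf at_top (\<lambda>y. ereal (a y))"
    using ereal_dense2[OF liminf_a] by blast
  obtain u where u: "Limsup at_top (\<lambda>y. ereal (a y)) < ereal u" "ereal u < 1"
    using ereal_dense2[OF limsup_a] by blast
  have "\<forall>\<^sub>F y in at_top. l < a y \<and> a y < u"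
    using less_LiminfD[OF l(2)] Limsup_lessD[OF u(1)] by eventually_elim simp
  then obtain Y where Y: "\<And>y. y \<ge> Y \<Longrightarrow> l < a y \<and> a y < u"
    unfolding eventually_at_top_linorder by blast
  show thesis
  \<comment> \<open>The number \<open>l\<close> bounds \<open>a\<close> from below and
    \<open>1 - u\<close> bounds \<open>1 - a\<close> from below; the cap \<open>1/2\<close> secures
    \<open>\<epsilon> < 1\<close>.\<close>
  proof (rule that[of "min (1/2) (min l (1 - u))" "max x\<^sub>b Y"])
    show "min (1/2) (min l (1 - u)) \<le> a y \<and> a y \<le> 1 - min (1/2) (min l (1 - u))"
      if "max x\<^sub>b Y \<le> y" for y
      using Y[of y] that by auto
  qed (use l u in auto)
qed

lemma b_mono: "x\<^sub>b \<le> y \<Longrightarrow> y \<le> y' \<Longrightarrow> b y' \<le> b y"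
  using b_antimono by (auto simp: monotone_on_def)

lemma b_exp_measurable [measurable]: "(\<lambda>u. b (exp u)) \<in> borel_measurable borel"
proof -
  have "exp \<in> measurable borel pos_borel"
    unfolding pos_borel_def by (intro measurable_restrict_space2) auto
  from measurable_compose[OF this b_meas] show ?thesis .
qed

abbreviation b_integral :: ennreal where
  "b_integral \<equiv> \<integral>\<^sup>+u\<in>{ln x\<^sub>b..}. ennreal (b (exp u)) \<partial>lborel"

section \<open>From an exploding upward path with positive limit fraction to a finite
  integral\<close>

text \<open>By \<open>1 - t \<le> exp (- t)\<close>, a positive lower bound for the products
  \<open>keep z n\<close> is an upper bound for the partial sums of \<open>b\<close>.\<close>

lemma summable_b_ups:
  assumes z: "z > 0" and "keep_lim z > 0"
  shows "summable (\<lambda>n. b (ups z n))"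
proof (rule summableI_nonneg_bounded)
  show "0 \<le> b (ups z n)" for n
    using b_bounds[OF ups_pos[OF z, of n]] by simp
  show "(\<Sum>i<n. b (ups z i)) \<le> - ln (keep_lim z)" for n
  proof -
    have "keep_lim z \<le> keep z n"
      by (rule decseq_ge[OF decseq_keep[OF z] keep_tendsto[OF z]])
    also have "keep z n \<le> (\<Prod>i<n. exp (- b (ups z i)))"
      unfolding keep_def
    proof (rule prod_mono)
      show "0 \<le> 1 - b (ups z i) \<and> 1 - b (ups z i) \<le> exp (- b (ups z i))" for i
        using b_bounds[OF ups_pos[OF z, of i]] exp_ge_add_one_self[of "- b (ups z i)"] by simp
    qed
    also have "\<dots> = exp (- (\<Sum>i<n. b (ups z i)))"
      by (simp flip: exp_sum sum_negf)
    finally have "ln (keep_lim z) \<le> - (\<Sum>i<n. b (ups z i))"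
      using assms(2) by (metis ln_exp ln_mono)
    then show ?thesis by simp
  qed
qed

text \<open>Beyond \<open>x\<^sub>b\<close> the logarithms of the path cut the half-line into cells
  of length at most \<open>c\<close>, and on each cell monotonicity bounds \<open>b\<close> by its
  value at the left end. So a multiple of the convergent series over \<open>b (w n)\<close>
  dominates the tail of the integral.\<close>

lemma b_integral_finite:
  assumes z: "z > 0" and unb: "\<not> bdd_above (range (ups z))" and "keep_lim z > 0"
  shows "b_integral < \<infinity>"
proof -
  obtain \<epsilon> Y where \<epsilon>: "0 < \<epsilon>" "\<epsilon> < 1" and Y: "x\<^sub>b \<le> Y" "\<And>y. y \<ge> Y \<Longrightarrow> \<epsilon> \<le> a y \<and> a y \<le> 1 - \<epsilon>"
    using a_tail_bounds by metis
  obtain N where N: "\<And>n. n \<ge> N \<Longrightarrow> Y \<le> ups z n"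
    using ups_at_top[OF z unb] unfolding filterlim_at_top eventually_sequentially by meson
  define w where "w n = ups z (N + n)" for n
  have wY: "Y \<le> w n" and w_pos: "0 < w n" for n
    unfolding w_def using N ups_pos[OF z] by auto
  have wxb: "x\<^sub>b \<le> w n" for n using wY[of n] Y(1) by simp
  \<comment> \<open>As \<open>1 - a\<close> stays above \<open>\<epsilon>\<close> and
    \<open>1 - b\<close> below 1, one step up multiplies the state by at most
    \<open>1 / \<epsilon>\<close>; \<open>c\<close> is the logarithm of that factor.\<close>
  define c where "c = - ln \<epsilon>"
  have c: "c \<ge> 0" unfolding c_def using \<epsilon> by simp
  have incr: "0 \<le> ln (w (Suc n)) - ln (w n)" "ln (w (Suc n)) - ln (w n) \<le> c" for n
  proof -
    have "w n \<le> w (Suc n)"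
      unfolding w_def using ups_mono[OF z] by simp
    then show "0 \<le> ln (w (Suc n)) - ln (w n)"
      using w_pos[of n] w_pos[of "Suc n"] by simp
    have "\<epsilon> \<le> 1 - a (w n)" using Y(2)[OF wY[of n]] by simp
    moreover have "(1 - b (w n)) * w n \<le> w n"
      using b_bounds[OF w_pos[of n]] w_pos[of n] by (simp add: algebra_simps)
    ultimately have "w (Suc n) \<le> w n / \<epsilon>"
      unfolding w_def using \<epsilon>(1) ups_pos[OF z, of "N + n"]
      by (auto simp: ups_Suc up_def intro!: frac_le)
    then have "ln (w (Suc n)) \<le> ln (w n / \<epsilon>)"
      using w_pos[of "Suc n"] w_pos[of n] \<epsilon>(1) by (intro ln_mono) auto
    then show "ln (w (Suc n)) - ln (w n) \<le> c"
      using w_pos[of n] \<epsilon>(1) by (simp add: c_def ln_div)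
  qed
  have summ: "summable (\<lambda>n. c * b (w n))"
    unfolding w_def using summable_b_ups[OF z assms(3)]
    by (intro summable_mult) (simp add: add.commute[of N] summable_iff_shift[of "\<lambda>n. b (ups z n)"])
  have bw: "0 < b (w n)" "b (w n) < 1" for n using b_bounds[OF w_pos[of n]] by auto
  have w_top: "filterlim w at_top sequentially"
  proof -
    have "strict_mono (\<lambda>n. N + n)" by (simp add: strict_mono_def)
    from filterlim_compose[OF ups_at_top[OF z unb] filterlim_subseq[OF this]]
    show ?thesis unfolding w_def[abs_def] .
  qed
  have term_le_suminf: "f p \<le> suminf f" for f :: "nat \<Rightarrow> ennreal" and p
    using sum_le_suminf[of f "{p}"] by simp
  \<comment> \<open>Before the path starts the integrand is at most 1. The closed cells overlap at
    their ends, which does no harm in an upper bound.\<close>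
  have "b_integral \<le> (\<integral>\<^sup>+u. indicator {ln x\<^sub>b..ln (w 0)} u
      + (\<Sum>n. ennreal (b (w n)) * indicator {ln (w n)..ln (w (Suc n))} u) \<partial>lborel)"
  proof (rule nn_integral_mono)
    fix u
    show "ennreal (b (exp u)) * indicator {ln x\<^sub>b..} u \<le> indicator {ln x\<^sub>b..ln (w 0)} u
      + (\<Sum>n. ennreal (b (w n)) * indicator {ln (w n)..ln (w (Suc n))} u)" (is "?l \<le> ?m + suminf ?r")
    proof (cases "u \<le> ln (w 0)")
      case True
      have "ennreal (b (exp u)) \<le> 1"
        using b_bounds[of "exp u"] by simp
      then have "?l \<le> ?m"
        using True by (auto simp: indicator_def)
      also have "\<dots> \<le> ?m + suminf ?r" by simp
      finally show ?thesis .
    next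
      case False
      obtain n where "exp u < w n"
        using w_top unfolding filterlim_at_top_dense eventually_sequentially by (meson order_refl)
      then have ex: "\<exists>n. u < ln (w n)"
        using w_pos by (metis ln_exp ln_less_cancel_iff exp_gt_zero)
      \<comment> \<open>The first state beyond \<open>exp u\<close>; it is not the state of index 0,
        so \<open>u\<close> lies in the cell that starts at its predecessor.\<close>
      define n where "n = (LEAST n. u < ln (w n))"
      have n: "u < ln (w n)" unfolding n_def by (rule LeastI_ex[OF ex])
      with False obtain p where p: "n = Suc p" by (cases n) auto
      have "\<not> u < ln (w p)"
        using not_less_Least[of p "\<lambda>n. u < ln (w n)"] p unfolding n_def by simp
      then have u: "ln (w p) \<le> u" "u \<le> ln (w (Suc p))" using n p by auto
      then have "w p \<le> exp u" using w_pos[of p] by (metis exp_le_cancel_iff exp_ln)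
      then have "b (exp u) \<le> b (w p)" using wxb[of p] by (intro b_mono)
      then have "?l \<le> ?r p" using u by (auto simp: indicator_def intro: ennreal_leI)
      also have "\<dots> \<le> suminf ?r" by (rule term_le_suminf[of ?r p])
      also have "\<dots> \<le> ?m + suminf ?r" by simp
      finally show ?thesis .
    qed
  qed
  also have "\<dots> = emeasure lborel {ln x\<^sub>b..ln (w 0)}
      + (\<Sum>n. ennreal (b (w n)) * emeasure lborel {ln (w n)..ln (w (Suc n))})"
    by (simp add: nn_integral_add nn_integral_suminf nn_integral_cmult_indicator)
  also have "\<dots> \<le> ennreal (ln (w 0) - ln x\<^sub>b) + (\<Sum>n. ennreal (c * b (w n)))"
  proof (intro add_mono suminf_le summableI)
    show "emeasure lborel {ln x\<^sub>b..ln (w 0)} \<le> ennreal (ln (w 0) - ln x\<^sub>b)"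
      using wxb[of 0] xb_pos w_pos[of 0] by simp
    show "ennreal (b (w n)) * emeasure lborel {ln (w n)..ln (w (Suc n))} \<le> ennreal (c * b (w n))" for n
    proof -
      have "emeasure lborel {ln (w n)..ln (w (Suc n))} = ennreal (ln (w (Suc n)) - ln (w n))"
        using incr(1)[of n] by simp
      then show ?thesis
        using bw[of n] incr[of n] by (auto simp: mult.commute[of c] intro!: ennreal_leI mult_left_mono simp flip: ennreal_mult)
    qed
  qed
  also have "\<dots> < \<infinity>"
  proof -
    have "(\<Sum>n. ennreal (c * b (w n))) = ennreal (\<Sum>n. c * b (w n))"
      using summ c bw by (intro suminf_ennreal2) (auto intro: mult_nonneg_nonneg less_imp_le)
    then show ?thesis by (simp only: ennreal_add_less_top infinity_ennreal_def ennreal_less_top simp_thms)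
  qed
  finally show ?thesis .
qed

section \<open>From a finite integral to exploding paths\<close>

text \<open>If \<open>b\<close> stayed above \<open>e\<close> on the whole half-line, the integral
  would be at least \<open>e\<close> times an infinite length; monotonicity extends one small value
  to all larger arguments.\<close>

lemma b_eventually_small:
  assumes "b_integral < \<infinity>" "e > 0"
  obtains y0 where "y0 \<ge> x\<^sub>b" "\<And>y. y \<ge> y0 \<Longrightarrow> b y < e"
proof -
  have "\<exists>y0\<ge>x\<^sub>b. b y0 < e"
  proof (rule ccontr)
    assume "\<not> (\<exists>y0\<ge>x\<^sub>b. b y0 < e)"
    then have ge: "e \<le> b y" if "x\<^sub>b \<le> y" for y using that by (meson not_le)
    have "ennreal e * emeasure lborel {ln x\<^sub>b..} = (\<integral>\<^sup>+u. ennreal e * indicator {ln x\<^sub>b..} u \<partial>lborel)"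
      by (simp add: nn_integral_cmult_indicator)
    also have "\<dots> \<le> b_integral"
    proof (rule nn_integral_mono)
      fix u :: real
      show "ennreal e * indicator {ln x\<^sub>b..} u \<le> ennreal (b (exp u)) * indicator {ln x\<^sub>b..} u"
        using ge[of "exp u"] xb_pos exp_le_cancel_iff[of "ln x\<^sub>b" u] by (auto simp: indicator_def intro!: ennreal_leI)
    qed
    also have "emeasure lborel {ln x\<^sub>b..} = \<infinity>"
    proof (rule ccontr)
      assume "emeasure lborel {ln x\<^sub>b..} \<noteq> \<infinity>"
      then have "emeasure lborel {ln x\<^sub>b..} < top"
        by (simp add: top.not_eq_extremum)
      \<comment> \<open>A finite length would lie below some \<open>n\<close>, yet the half-line
        contains an interval of length \<open>n\<close>.\<close>
      then obtain n where "emeasure lborel {ln x\<^sub>b..} < of_nat n"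
        using ennreal_Ex_less_of_nat by blast
      also have "of_nat n = emeasure lborel {ln x\<^sub>b..ln x\<^sub>b + real n}"
        by (simp add: ennreal_of_nat_eq_real_of_nat)
      also have "\<dots> \<le> emeasure lborel {ln x\<^sub>b..}"
        by (intro emeasure_mono) auto
      finally show False by simp
    qed
    finally show False using assms by (simp add: ennreal_mult_top top.not_eq_extremum)
  qed
  then obtain y0 where "y0 \<ge> x\<^sub>b" "b y0 < e" by blast
  then show thesis using b_mono[of y0] by (intro that[of y0]) (auto intro: le_less_trans)
qed

text \<open>Converse of \<open>summable_b_ups\<close>: an absolutely convergent product without
  vanishing factors has a nonzero limit.\<close>

lemma keep_lim_pos:
  assumes z: "z > 0" and "summable (\<lambda>n. b (ups z n))"
  shows "keep_lim z > 0"
proof -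
  have b: "0 < b (ups z n)" "b (ups z n) < 1" for n
    using b_bounds[OF ups_pos[OF z, of n]] by auto
  have "summable (\<lambda>n. norm (1 - b (ups z n) - 1))"
    using assms(2) b(1) by (simp add: less_imp_le)
  then have "convergent_prod (\<lambda>n. 1 - b (ups z n))"
    by (intro abs_convergent_prod_imp_convergent_prod summable_imp_abs_convergent_prod)
  then obtain L where L: "(\<lambda>n. \<Prod>i\<le>n. 1 - b (ups z i)) \<longlonglongrightarrow> L" "L \<noteq> 0"
    using convergent_prod_iff_nz_lim[of "\<lambda>n. 1 - b (ups z n)"] b(2) by (auto simp: less_imp_neq)
  \<comment> \<open>The library product runs over \<open>i \<le> n\<close>, whereas
    \<open>keep z n\<close> runs over \<open>i < n\<close>; hence the shift by one.\<close>
  have "(\<lambda>n. keep z (Suc n)) \<longlonglongrightarrow> L"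
    using L(1) by (simp only: keep_def lessThan_Suc_atMost)
  then have "L = keep_lim z"
    using LIMSEQ_unique LIMSEQ_Suc[OF keep_tendsto[OF z]] by blast
  with L(2) keep_lim_bounds(1)[OF z] show ?thesis by simp
qed

text \<open>Where \<open>b\<close> is small, \<open>ln\<close> of the path grows by at least a fixed
  \<open>\<delta>\<close> per step, which forces explosion. The same lower bound on the cell lengths
  makes the integral dominate \<open>\<delta>\<close> times the series of \<open>b\<close> along any
  exploding path, wherever it starts.\<close>

lemma eventually_ups_explode:
  assumes fin: "b_integral < \<infinity>"
  obtains Y where "\<And>z. z \<ge> Y \<Longrightarrow> \<not> bdd_above (range (ups z))"
    and "\<And>z. z > 0 \<Longrightarrow> \<not> bdd_above (range (ups z)) \<Longrightarrow> keep_lim z > 0"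
proof -
  obtain \<epsilon> Y1 where \<epsilon>: "0 < \<epsilon>" "\<epsilon> < 1" and Y1: "x\<^sub>b \<le> Y1" "\<And>y. y \<ge> Y1 \<Longrightarrow> \<epsilon> \<le> a y \<and> a y \<le> 1 - \<epsilon>"
    using a_tail_bounds by metis
  \<comment> \<open>With \<open>b < \<epsilon> / 2\<close> and \<open>a \<ge> \<epsilon>\<close>,
    the growth factor \<open>(1 - b) / (1 - a)\<close> is at least the constant \<open>r > 1\<close>
    below.\<close>
  obtain Y2 where Y2: "Y2 \<ge> x\<^sub>b" "\<And>y. y \<ge> Y2 \<Longrightarrow> b y < \<epsilon> / 2"
    using b_eventually_small[OF fin, of "\<epsilon> / 2"] \<epsilon> by auto
  define Y where "Y = max Y1 Y2"
  have Yxb: "x\<^sub>b \<le> Y" and Y_pos: "Y > 0" using Y1(1) xb_pos by (auto simp: Y_def)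
  define r where "r = (1 - \<epsilon> / 2) / (1 - \<epsilon>)"
  have r: "r > 1" unfolding r_def using \<epsilon> by (simp add: field_simps)
  define \<delta> where "\<delta> = ln r"
  have \<delta>: "\<delta> > 0" unfolding \<delta>_def using r by simp
  have incr: "ln y + \<delta> \<le> ln (up a b y)" if "Y \<le> y" for y
  proof -
    have y: "y > 0" using that Y_pos by simp
    have "r \<le> (1 - b y) / (1 - a y)"
      unfolding r_def using Y1(2)[of y] Y2(2)[of y] that \<epsilon> ab[OF y] by (intro frac_le) (auto simp: Y_def)
    then have "r * y \<le> up a b y"
      unfolding up_def using y by (metis mult_right_mono less_imp_le times_divide_eq_left)
    moreover have "0 < r * y" using r y by simp
    ultimately have "ln (r * y) \<le> ln (up a b y)" by (intro ln_mono) auto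
    then show ?thesis using r y by (simp add: \<delta>_def ln_mult)
  qed
  have explode: "\<not> bdd_above (range (ups z))" if z: "z \<ge> Y" for z
  proof
    have z_pos: "z > 0" using z Y_pos by simp
    have "ln z + real n * \<delta> \<le> ln (ups z n)" for n
    proof (induction n)
      case (Suc n)
      have "Y \<le> ups z n" using ups_mono[OF z_pos, of 0 n] z by simp
      from incr[OF this] Suc show ?case by (simp add: ups_Suc algebra_simps)
    qed simp
    moreover assume "bdd_above (range (ups z))"
    then obtain C where C: "\<And>n. ups z n \<le> C" by (auto simp: bdd_above_def)
    have "ln (ups z n) \<le> ln C" for n using C ups_pos[OF z_pos] by (intro ln_mono) auto
    ultimately have le: "ln z + real n * \<delta> \<le> ln C" for n
      by (rule order_trans)
    obtain n where "ln C - ln z < real n * \<delta>"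
      using reals_Archimedean3[OF \<delta>] by blast
    with le[of n] show False by linarith
  qed
  have "keep_lim z > 0" if z: "z > 0" and unb: "\<not> bdd_above (range (ups z))" for z
  proof (rule keep_lim_pos[OF z])
    obtain N where N: "\<And>n. n \<ge> N \<Longrightarrow> Y \<le> ups z n"
      using ups_at_top[OF z unb] unfolding filterlim_at_top eventually_sequentially by meson
    define w where "w n = ups z (n + N)" for n
    have wY: "Y \<le> w n" and w_pos: "0 < w n" for n
      unfolding w_def using N ups_pos[OF z] by auto
    have w_Suc: "ln (w n) + \<delta> \<le> ln (w (Suc n))" for n
      using incr[OF wY[of n]] by (simp add: w_def ups_Suc)
    \<comment> \<open>Half-open cells are disjoint, so at each point at most one term of the series
      below survives.\<close>
    define J where "J n = {ln (w n)..<ln (w (Suc n))}" for n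
    have lnw_mono: "ln (w m) \<le> ln (w n)" if "m \<le> n" for m n
      using that w_pos ups_mono[OF z] by (auto simp: w_def)
    have disj: "disjoint_family J"
    proof (unfold disjoint_family_on_def, intro ballI impI)
      fix m n :: nat assume "m \<noteq> n"
      then consider "Suc m \<le> n" | "Suc n \<le> m" by linarith
      then show "J m \<inter> J n = {}"
        by cases (use lnw_mono in \<open>force simp: J_def\<close>)+
    qed
    \<comment> \<open>A lower bound for the integral needs the smallest value of \<open>b\<close> on
      the cell, the one at the right end; hence the index \<open>Suc n\<close>.\<close>
    have "(\<Sum>n. ennreal (b (w (Suc n)) * \<delta>)) \<le> (\<Sum>n. ennreal (b (w (Suc n))) * emeasure lborel (J n))"
    proof (intro suminf_le summableI)
      fix n
      have "emeasure lborel (J n) = ennreal (ln (w (Suc n)) - ln (w n))"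
        unfolding J_def using lnw_mono[of n "Suc n"] by simp
      then show "ennreal (b (w (Suc n)) * \<delta>) \<le> ennreal (b (w (Suc n))) * emeasure lborel (J n)"
        using w_Suc[of n] b_bounds[OF w_pos[of "Suc n"]] \<delta>
        by (auto intro!: ennreal_leI mult_left_mono simp flip: ennreal_mult)
    qed
    also have "\<dots> = (\<integral>\<^sup>+u. (\<Sum>n. ennreal (b (w (Suc n))) * indicator (J n) u) \<partial>lborel)"
      by (simp add: nn_integral_suminf nn_integral_cmult_indicator J_def)
    also have "\<dots> \<le> b_integral"
    proof (rule nn_integral_mono)
      fix u
      show "(\<Sum>n. ennreal (b (w (Suc n))) * indicator (J n) u) \<le> ennreal (b (exp u)) * indicator {ln x\<^sub>b..} u"
      proof (cases "\<exists>n. u \<in> J n")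
        case True
        then obtain n where n: "u \<in> J n" by blast
        have "ln x\<^sub>b \<le> ln (w n)" using wY[of n] Yxb xb_pos by (intro ln_mono) auto
        then have u: "ln x\<^sub>b \<le> u" "u < ln (w (Suc n))" using n by (auto simp: J_def)
        then have "x\<^sub>b \<le> exp u" "exp u \<le> w (Suc n)"
          using xb_pos w_pos[of "Suc n"] by (metis exp_le_cancel_iff exp_ln, metis exp_le_cancel_iff exp_ln less_imp_le)
        then have "b (w (Suc n)) \<le> b (exp u)" by (rule b_mono)
        then show ?thesis
          unfolding suminf_cmult_indicator[OF disj n, of "\<lambda>n. ennreal (b (w (Suc n)))"]
          using u(1) by (simp add: ennreal_leI)
      qed simp
    qed
    also have "\<dots> < \<infinity>" by (rule fin)
    finally have "summable (\<lambda>n. b (w (Suc n)) * \<delta>)"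
      using b_bounds[OF w_pos] \<delta> by (intro summable_suminf_not_top) (auto simp: less_imp_le)
    then have "summable (\<lambda>n. b (w (Suc n)))"
      using \<delta> by (simp add: summable_cmult_iff mult.commute[of _ \<delta>])
    then have "summable (\<lambda>n. b (w n))"
      using summable_Suc_iff[of "\<lambda>n. b (w n)"] by blast
    then show "summable (\<lambda>n. b (ups z n))"
      unfolding w_def using summable_iff_shift[of "\<lambda>n. b (ups z n)" N] by simp
  qed
  with explode show thesis by (rule that)
qed

end

section \<open>Loss of expectation between consecutive drops\<close>

locale two_point_chain = two_point_parameters +
  fixes x :: real and M :: "'w measure" and S :: "nat \<Rightarrow> 'w \<Rightarrow> real"
  assumes x_pos: "x > 0"
    and chain: "markov_chain_from M pos_borel (two_point_kernel a b) x S"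
begin

sublocale prob_space M
  using chain by (simp add: markov_chain_from_def)

section \<open>Natural filtration and one-step transitions\<close>

abbreviation F :: "nat \<Rightarrow> 'w measure" where
  "F \<equiv> natural_filtration M pos_borel S"

lemma S_pos_borel: "S n \<in> measurable M pos_borel"
  using chain by (simp add: markov_chain_from_def)

lemma subalg: "subalgebra M (F n)"
  by (rule subalgebra_natural_filtration) (rule S_pos_borel)

lemma F_sets: "A \<in> sets (F n) \<Longrightarrow> A \<in> sets M"
  using subalg[of n] by (auto simp: subalgebra_def)

lemma S_pos: "\<omega> \<in> space M \<Longrightarrow> S n \<omega> > 0"
  using measurable_space[OF S_pos_borel, of \<omega> n] by (simp add: space_pos_borel)

lemma S_adapted: "k \<le> n \<Longrightarrow> S k \<in> borel_measurable (F n)"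
proof -
  assume "k \<le> n"
  then have "S k \<in> measurable (F n) pos_borel"
    by (intro measurableI) (auto simp: space_pos_borel S_pos intro: sets_natural_filtration_generator)
  then show ?thesis
    unfolding pos_borel_def measurable_restrict_space2_iff by blast
qed

lemma S_borel [measurable]: "S n \<in> borel_measurable M"
  using S_pos_borel[of n] unfolding pos_borel_def measurable_restrict_space2_iff by blast

text \<open>Integrating the conditional probability over an event of \<open>F n\<close> on which
  \<open>S n\<close> is constant turns the kernel into a plain factor. All path probabilities below
  rest on this form of the Markov property.\<close>

lemma step_prob:
  assumes A: "A \<in> sets (F n)" and y: "\<And>\<omega>. \<omega> \<in> A \<Longrightarrow> S n \<omega> = y" "y > 0"
    and C: "C \<in> sets pos_borel"
  shows "prob {\<omega>\<in>A. S (Suc n) \<omega> \<in> C}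
    = prob A * (a y * indicator C (down a b y) + (1 - a y) * indicator C (up a b y))"
proof -
  interpret G: finite_measure_subalgebra M "F n"
    by unfold_locales (rule subalg)
  define g where "g \<omega> = (indicator C (S (Suc n) \<omega>) :: real)" for \<omega>
  have g_meas [measurable]: "g \<in> borel_measurable M"
    unfolding g_def using measurable_compose[OF S_pos_borel borel_measurable_indicator[OF C]] .
  have g_int: "integrable M g"
    by (rule integrable_const_bound[where B=1]) (auto simp: g_def indicator_def)
  have [measurable]: "A \<in> sets M" by (rule F_sets[OF A])
  have set_eq: "{\<omega>\<in>A. S (Suc n) \<omega> \<in> C} = A \<inter> (S (Suc n) -` C \<inter> space M)"
    using sets.sets_into_space[OF F_sets[OF A]] by auto
  have meas: "{\<omega>\<in>A. S (Suc n) \<omega> \<in> C} \<in> sets M"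
    unfolding set_eq using measurable_sets[OF S_pos_borel C] by auto
  have AE: "AE \<omega> in M. real_cond_exp M (F n) g \<omega> = measure (two_point_kernel a b (S n \<omega>)) C"
    using chain C unfolding markov_chain_from_def g_def by blast
  have "prob {\<omega>\<in>A. S (Suc n) \<omega> \<in> C} = (\<integral>\<omega>. indicator {\<omega>\<in>A. S (Suc n) \<omega> \<in> C} \<omega> \<partial>M)"
    using meas by simp
  also have "\<dots> = (\<integral>\<omega>\<in>A. g \<omega> \<partial>M)"
    unfolding set_lebesgue_integral_def
    by (intro Bochner_Integration.integral_cong) (auto simp: g_def indicator_def)
  also have "\<dots> = (\<integral>\<omega>\<in>A. real_cond_exp M (F n) g \<omega> \<partial>M)"
    by (rule G.real_cond_exp_intA[OF g_int A])
  also have "\<dots> = (\<integral>\<omega>\<in>A. measure (two_point_kernel a b y) C \<partial>M)"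
    unfolding set_lebesgue_integral_def
  proof (rule integral_cong_AE)
    show "AE \<omega> in M. indicator A \<omega> *\<^sub>R real_cond_exp M (F n) g \<omega>
      = indicator A \<omega> *\<^sub>R measure (two_point_kernel a b y) C"
      using AE by eventually_elim (auto simp: indicator_def y)
  qed measurable
  also have "\<dots> = prob A * measure (two_point_kernel a b y) C"
    by (simp add: set_lebesgue_integral_def)
  finally show ?thesis
    by (simp add: measure_kernel[OF y(2) C])
qed

text \<open>For each fixed state, any other successor has probability 0. Only finitely many states
  are possible at each time, so the exceptional null sets can be united, and induction keeps the
  chain in the layers.\<close>

lemma AE_step: "AE \<omega> in M. \<forall>n. S n \<omega> \<in> layer x n \<and> S (Suc n) \<omega> \<in> {up a b (S n \<omega>), down a b (S n \<omega>)}"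
proof -
  have stepz: "AE \<omega> in M. S n \<omega> = z \<longrightarrow> S (Suc n) \<omega> \<in> {up a b z, down a b z}" if z: "z > 0" for n z
  proof -
    define C where "C = space pos_borel - {up a b z, down a b z}"
    have C: "C \<in> sets pos_borel"
      unfolding C_def using singleton_pos_borel[OF up_pos[OF z]] singleton_pos_borel[OF down_pos[OF z]]
      by (metis insert_is_Un sets.Un sets.compl_sets)
    note [measurable] = S_adapted[OF order_refl]
    define A where "A = {\<omega>\<in>space (F n). S n \<omega> = z}"
    have A: "A \<in> sets (F n)" unfolding A_def by measurable
    have "prob {\<omega>\<in>A. S (Suc n) \<omega> \<in> C} = 0"
      by (subst step_prob[OF A _ z C]) (auto simp: A_def C_def)
    moreover have "{\<omega>\<in>A. S (Suc n) \<omega> \<in> C} = A \<inter> (S (Suc n) -` C \<inter> space M)"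
      by (auto simp: A_def)
    then have "{\<omega>\<in>A. S (Suc n) \<omega> \<in> C} \<in> sets M"
      using F_sets[OF A] measurable_sets[OF S_pos_borel C] by auto
    ultimately have "AE \<omega> in M. \<omega> \<notin> {\<omega>\<in>A. S (Suc n) \<omega> \<in> C}"
      by (subst AE_iff_null_sets[symmetric]) (auto simp: null_sets_def emeasure_eq_measure)
    then show ?thesis
      by (rule AE_mp) (rule AE_I2, auto simp: A_def C_def S_pos space_pos_borel)
  qed
  have "AE \<omega> in M. \<forall>n. \<forall>z\<in>layer x n. S n \<omega> = z \<longrightarrow> S (Suc n) \<omega> \<in> {up a b z, down a b z}"
    unfolding AE_all_countable
    using layer_pos[OF x_pos] stepz by (intro allI AE_ball_countable' countable_finite finite_layer) auto
  moreover have "AE \<omega> in M. S 0 \<omega> = x"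
    using chain by (simp add: markov_chain_from_def)
  ultimately show ?thesis
  proof eventually_elim
    case (elim \<omega>)
    have "S n \<omega> \<in> layer x n" for n
    proof (induction n)
      case (Suc n)
      then show ?case using elim(1) by fastforce
    qed (use elim in auto)
    then show ?case using elim by blast
  qed
qed

section \<open>Measurability of the drop times\<close>

lemma F_mono: "m \<le> n \<Longrightarrow> sets (F m) \<subseteq> sets (F n)"
proof -
  let ?G = "\<lambda>n. \<Union>k\<in>{..n}. {S k -` A \<inter> space M |A. A \<in> sets pos_borel}"
  assume "m \<le> n"
  then have "?G m \<subseteq> ?G n"
    by (intro UN_mono) auto
  then have "sigma_sets (space M) (?G m) \<subseteq> sigma_sets (space M) (?G n)"
    by (rule sigma_sets_mono')
  moreover have "sets (F n) = sigma_sets (space M) (?G n)" for n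
    unfolding natural_filtration_def by (rule sets_measure_of) auto
  ultimately show ?thesis by simp
qed

text \<open>The drop times are stopping times. Stating this for every \<open>N \<ge> n\<close> lets
  the induction hypothesis for earlier times \<open>m\<close> be used with the same
  \<open>N\<close>.\<close>

lemma drop_time_pred: "n \<le> N \<Longrightarrow> Measurable.pred (F N) (\<lambda>\<omega>. drop_time S k \<omega> = enat n)"
proof (induction k arbitrary: n)
  case (Suc k)
  have drop: "Measurable.pred (F N) (\<lambda>\<omega>. S j \<omega> < S (j - 1) \<omega>)" if "j \<le> n" for j
    using that Suc.prems by (intro borel_measurable_pred_less S_adapted) auto
  have "Measurable.pred (F N) (\<lambda>\<omega>. drop_time S k \<omega> = enat m \<and> (\<forall>j\<in>{m<..<n}. \<not> S j \<omega> < S (j - 1) \<omega>))"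
    if "m < n" for m
    using that Suc.prems
    by (intro pred_intros_logic(2,3) pred_intros_countable_bounded(3) Suc.IH drop) auto
  then show ?case
    unfolding drop_time_Suc_eq_enat_iff
    by (intro pred_intros_logic(3)[OF pred_intros_countable(2)[OF pred_intros_conj1']] drop) auto
qed simp

section \<open>The value at a drop time and its expectation\<close>

abbreviation V :: "nat \<Rightarrow> 'w \<Rightarrow> real" where
  "V k \<omega> \<equiv> value_at S (drop_time S k \<omega>) \<omega>"

text \<open>The drop time has countably many values, so it suffices that its fibres are events and
  that the value at each fixed time, including infinity, is measurable.\<close>

lemma V_borel [measurable]: "V k \<in> borel_measurable M"
proof -
  have enat_eq: "(\<lambda>\<omega>. drop_time S k \<omega>) -` {enat n} \<inter> space M \<in> sets M" for n
  proof -
    have "(\<lambda>\<omega>. drop_time S k \<omega>) -` {enat n} \<inter> space M = {\<omega>\<in>space (F n). drop_time S k \<omega> = enat n}"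
      by auto
    also have "\<dots> \<in> sets M"
      by (intro F_sets[of _ n] predE drop_time_pred) simp
    finally show ?thesis .
  qed
  have "(\<lambda>\<omega>. drop_time S k \<omega>) -` {\<infinity>} \<inter> space M
      = space M - (\<Union>n. (\<lambda>\<omega>. drop_time S k \<omega>) -` {enat n} \<inter> space M)"
    by (auto simp: not_infinity_eq)
  then have "(\<lambda>\<omega>. drop_time S k \<omega>) -` {\<infinity>} \<inter> space M \<in> sets M"
    using enat_eq by (simp only:) (intro sets.Diff sets.top sets.countable_UN, blast)
  then have "(\<lambda>\<omega>. drop_time S k \<omega>) -` {t} \<inter> space M \<in> sets M" for t
    using enat_eq by (cases t) auto
  then have "(\<lambda>\<omega>. drop_time S k \<omega>) \<in> measurable M (count_space UNIV)"
    by (subst measurable_count_space_eq2_countable) auto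
  moreover have "value_at S t \<in> borel_measurable M" for t
  proof (cases t)
    case (enat n)
    then show ?thesis unfolding value_at_def by simp
  next
    case infinity
    then show ?thesis unfolding value_at_def limit_value_def by simp
  qed
  ultimately show ?thesis
    by (rule measurable_compose_countable[where f="value_at S" and g="drop_time S k", rotated])
qed

text \<open>A measure whose total mass is the expectation in the definition of
  \<open>bubble\<close>; it can be cut additively along events without any integrability.\<close>

definition law :: "nat \<Rightarrow> 'w measure" where
  "law k = density M (\<lambda>\<omega>. ennreal (V k \<omega>))"

lemma sets_law [simp]: "sets (law k) = sets M"
  and space_law [simp]: "space (law k) = space M"
  by (simp_all add: law_def)

lemma emeasure_law_space: "emeasure (law k) (space M) = (\<integral>\<^sup>+\<omega>. ennreal (V k \<omega>) \<partial>M)"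
  unfolding law_def by (subst emeasure_density) (auto intro!: nn_integral_cong)

lemma AE_law: "(AE \<omega> in M. P \<omega>) \<Longrightarrow> AE \<omega> in law k. P \<omega>"
  unfolding law_def by (subst AE_density) (auto elim: AE_mp)

lemma emeasure_law_const:
  assumes "B \<in> sets M" "\<And>\<omega>. \<omega> \<in> B \<Longrightarrow> V k \<omega> = c" "c \<ge> 0"
  shows "emeasure (law k) B = ennreal (c * prob B)"
proof -
  have "emeasure (law k) B = (\<integral>\<^sup>+\<omega>. ennreal (V k \<omega>) * indicator B \<omega> \<partial>M)"
    unfolding law_def using assms(1) by (subst emeasure_density) auto
  also have "\<dots> = (\<integral>\<^sup>+\<omega>. ennreal c * indicator B \<omega> \<partial>M)"
    using assms(2) by (intro nn_integral_cong) (auto simp: indicator_def)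
  also have "\<dots> = ennreal (c * prob B)"
    using assms by (simp add: nn_integral_cmult_indicator emeasure_eq_measure ennreal_mult)
  finally show ?thesis .
qed

section \<open>Decomposition according to the state at a drop time\<close>

definition atom :: "nat \<Rightarrow> nat \<Rightarrow> real \<Rightarrow> 'w set" where
  "atom k m z = {\<omega>\<in>space M. drop_time S k \<omega> = enat m \<and> S m \<omega> = z}"

text \<open>Up to a null set, the intersection over \<open>n\<close> is the part of the atom on
  which no further drop follows.\<close>

definition rise :: "nat \<Rightarrow> nat \<Rightarrow> real \<Rightarrow> nat \<Rightarrow> 'w set" where
  "rise k m z n = {\<omega>\<in>atom k m z. \<forall>i\<le>n. S (m + i) \<omega> = ups z i}"

definition fall :: "nat \<Rightarrow> nat \<Rightarrow> real \<Rightarrow> nat \<Rightarrow> 'w set" where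
  "fall k m z n = {\<omega>\<in>rise k m z n. S (Suc (m + n)) \<omega> = down a b (ups z n)}"

lemma atom_sets: "atom k m z \<in> sets (F m)"
proof -
  have "atom k m z = {\<omega>\<in>space (F m). drop_time S k \<omega> = enat m \<and> S m \<omega> = z}"
    by (simp add: atom_def)
  also have "\<dots> \<in> sets (F m)"
    by (intro predE pred_intros_logic(3) drop_time_pred pred_eq_const1[where N=borel] S_adapted) auto
  finally show ?thesis .
qed

context
  fixes k m :: nat and z :: real
  assumes z: "z > 0"
begin

lemma rise_Suc: "rise k m z (Suc n) = {\<omega>\<in>rise k m z n. S (Suc (m + n)) \<omega> \<in> {ups z (Suc n)}}"
  by (auto simp: rise_def le_Suc_eq)

lemma fall_eq: "fall k m z n = {\<omega>\<in>rise k m z n. S (Suc (m + n)) \<omega> \<in> {down a b (ups z n)}}"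
  by (auto simp: fall_def)

lemma rise_sets: "rise k m z n \<in> sets (F (m + n))"
proof -
  have "rise k m z n = atom k m z \<inter> {\<omega>\<in>space (F (m + n)). \<forall>i\<in>{..n}. S (m + i) \<omega> = ups z i}"
    by (auto simp: rise_def atom_def)
  moreover have "{\<omega>\<in>space (F (m + n)). \<forall>i\<in>{..n}. S (m + i) \<omega> = ups z i} \<in> sets (F (m + n))"
    by (intro predE pred_intros_countable_bounded(3) pred_eq_const1[where N=borel] S_adapted) auto
  moreover have "atom k m z \<in> sets (F (m + n))"
    using atom_sets F_mono[of m "m + n"] by auto
  ultimately show ?thesis by (simp only: sets.Int)
qed

lemma rise_events: "rise k m z n \<in> sets M"
  by (rule F_sets[OF rise_sets])

lemma Inter_rise_events: "(\<Inter>n. rise k m z n) \<in> sets M"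
  using rise_events by (intro sets.countable_INT) auto

lemma fall_events: "fall k m z n \<in> sets M"
proof -
  have "fall k m z n = rise k m z n \<inter> {\<omega>\<in>space M. S (Suc (m + n)) \<omega> = down a b (ups z n)}"
    by (auto simp: fall_def rise_def atom_def)
  then show ?thesis using rise_events by simp
qed

lemma rise_value: "\<omega> \<in> rise k m z n \<Longrightarrow> S (m + n) \<omega> = ups z n"
  by (auto simp: rise_def)

lemma prob_rise: "prob (rise k m z n) = prob (atom k m z) * (\<Prod>i<n. 1 - a (ups z i))"
proof (induction n)
  case 0
  have "rise k m z 0 = atom k m z" by (auto simp: rise_def atom_def)
  then show ?case by simp
next
  case (Suc n)
  \<comment> \<open>The two successors differ, so the singleton of the upper one receives the weight
    \<open>1 - a\<close> only.\<close>
  have "down a b (ups z n) \<noteq> up a b (ups z n)"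
    using up_greater[OF ups_pos[OF z, of n]] down_less[OF ups_pos[OF z, of n]] by simp
  then have "prob (rise k m z (Suc n)) = prob (rise k m z n) * (1 - a (ups z n))"
    unfolding rise_Suc
    by (subst step_prob[OF rise_sets rise_value ups_pos[OF z] singleton_pos_borel[OF ups_pos[OF z]]])
      (auto simp: ups_Suc)
  with Suc show ?case by simp
qed

lemma prob_fall: "prob (fall k m z n) = prob (atom k m z) * (\<Prod>i<n. 1 - a (ups z i)) * a (ups z n)"
proof -
  have "down a b (ups z n) \<noteq> up a b (ups z n)"
    using up_greater[OF ups_pos[OF z, of n]] down_less[OF ups_pos[OF z, of n]] by simp
  then have "prob (fall k m z n) = prob (rise k m z n) * a (ups z n)"
    unfolding fall_eq
    by (subst step_prob[OF rise_sets rise_value ups_pos[OF z] singleton_pos_borel[OF down_pos[OF ups_pos[OF z]]]])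
      auto
  then show ?thesis by (simp add: prob_rise)
qed

lemma rise_no_drop:
  assumes "\<omega> \<in> rise k m z n" "m < j" "j \<le> m + n"
  shows "\<not> S j \<omega> < S (j - 1) \<omega>"
proof -
  define i where "i = j - m - 1"
  have j: "j = m + Suc i" "Suc i \<le> n" using assms(2,3) by (auto simp: i_def)
  then have "S j \<omega> = ups z (Suc i)" "S (j - 1) \<omega> = ups z i"
    using assms(1) by (auto simp: rise_def)
  then show ?thesis using ups_mono[OF z, of i "Suc i"] by simp
qed

lemma drop_time_fall:
  assumes "\<omega> \<in> fall k m z n"
  shows "drop_time S (Suc k) \<omega> = enat (Suc (m + n))" "S (Suc (m + n)) \<omega> = down a b (ups z n)"
proof -
  have r: "\<omega> \<in> rise k m z n" and d: "S (Suc (m + n)) \<omega> = down a b (ups z n)"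
    using assms by (auto simp: fall_def)
  have "S (Suc (m + n)) \<omega> < S (m + n) \<omega>"
    using down_less[OF ups_pos[OF z, of n]] rise_value[OF r] d by simp
  moreover have "drop_time S k \<omega> = enat m" using r by (auto simp: rise_def atom_def)
  ultimately show "drop_time S (Suc k) \<omega> = enat (Suc (m + n))"
    unfolding drop_time_Suc_eq_enat_iff using rise_no_drop[OF r] by auto
  show "S (Suc (m + n)) \<omega> = down a b (ups z n)" by (rule d)
qed

text \<open>A run that does not rise forever has a first departure from the upward path, and there
  the only other successor is the lower one.\<close>

lemma AE_atom_split: "AE \<omega> in M. \<omega> \<in> atom k m z \<longleftrightarrow> \<omega> \<in> (\<Union>n. fall k m z n) \<union> (\<Inter>n. rise k m z n)"
  using AE_step
proof eventually_elim
  case (elim \<omega>)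
  show ?case
  proof
    assume at: "\<omega> \<in> atom k m z"
    show "\<omega> \<in> (\<Union>n. fall k m z n) \<union> (\<Inter>n. rise k m z n)"
    proof (cases "\<forall>n. \<omega> \<in> rise k m z n")
      case False
      define n where "n = (LEAST n. \<omega> \<notin> rise k m z n)"
      have n: "\<omega> \<notin> rise k m z n"
        unfolding n_def by (rule LeastI_ex) (use False in blast)
      have "\<omega> \<in> rise k m z 0" using at by (auto simp: rise_def atom_def)
      with n obtain p where p: "n = Suc p" by (cases n) auto
      have r: "\<omega> \<in> rise k m z p"
        using not_less_Least[of p "\<lambda>n. \<omega> \<notin> rise k m z n"] p unfolding n_def by auto
      moreover have "S (Suc (m + p)) \<omega> \<noteq> ups z (Suc p)"
        using n r unfolding p rise_Suc by auto
      ultimately have "\<omega> \<in> fall k m z p"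
        using elim rise_value[OF r] unfolding fall_def ups_Suc by (metis (mono_tags) insertE mem_Collect_eq singletonD)
      then show ?thesis by blast
    qed auto
  qed (auto simp: fall_def rise_def)
qed

text \<open>The factor \<open>a\<close> of the probability cancels against the denominator of
  \<open>down\<close>; what remains is a difference of consecutive values of \<open>keep z\<close>,
  so the series telescopes.\<close>

lemma keep_sums: "(\<lambda>n. prob (fall k m z n) * down a b (ups z n)) sums (prob (atom k m z) * z * (1 - keep_lim z))"
proof -
  have "prob (fall k m z n) * down a b (ups z n) = prob (atom k m z) * z * (keep z n - keep z (Suc n))" for n
  proof -
    have "a (ups z n) \<noteq> 0" using ab[OF ups_pos[OF z, of n]] by simp
    then have "prob (fall k m z n) * down a b (ups z n)
        = prob (atom k m z) * b (ups z n) * (ups z n * (\<Prod>i<n. 1 - a (ups z i)))"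
      by (simp add: prob_fall down_def)
    then show ?thesis
      by (simp add: ups_times_prob[OF z] keep_simps algebra_simps)
  qed
  moreover have "(\<lambda>n. prob (atom k m z) * z * (keep z n - keep z (Suc n))) sums (prob (atom k m z) * z * (keep z 0 - keep_lim z))"
    by (intro sums_mult telescope_sums' keep_tendsto z)
  ultimately show ?thesis by (simp add: keep_simps)
qed

text \<open>The falls are disjoint because they fix different next drop times, and on each of them
  the new value is constant. The mass on the event of rising forever is left open: it depends on
  whether the path converges.\<close>

lemma law_Suc_atom:
  "emeasure (law (Suc k)) (atom k m z)
    = ennreal (prob (atom k m z) * z * (1 - keep_lim z)) + emeasure (law (Suc k)) (\<Inter>n. rise k m z n)"
proof -
  have disj: "disjoint_family (fall k m z)"
  proof (unfold disjoint_family_on_def, intro ballI impI)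
    fix i j :: nat assume "i \<noteq> j"
    then show "fall k m z i \<inter> fall k m z j = {}"
      by (auto dest!: drop_time_fall(1))
  qed
  have disj': "(\<Union>n. fall k m z n) \<inter> (\<Inter>n. rise k m z n) = {}"
  proof (rule ccontr)
    assume "(\<Union>n. fall k m z n) \<inter> (\<Inter>n. rise k m z n) \<noteq> {}"
    then obtain n \<omega> where "\<omega> \<in> fall k m z n" "\<omega> \<in> rise k m z (Suc n)" by blast
    then have "down a b (ups z n) = up a b (ups z n)"
      by (auto simp: fall_def rise_Suc ups_Suc)
    then show False
      using up_greater[OF ups_pos[OF z, of n]] down_less[OF ups_pos[OF z, of n]] by simp
  qed
  have [measurable]: "(\<Inter>n. rise k m z n) \<in> sets M" "(\<Union>n. fall k m z n) \<in> sets M"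
    using Inter_rise_events fall_events by auto
  have "emeasure (law (Suc k)) (atom k m z) = emeasure (law (Suc k)) ((\<Union>n. fall k m z n) \<union> (\<Inter>n. rise k m z n))"
    using AE_law[OF AE_atom_split] by (intro emeasure_eq_AE) (auto simp: F_sets[OF atom_sets])
  also have "\<dots> = emeasure (law (Suc k)) (\<Union>n. fall k m z n) + emeasure (law (Suc k)) (\<Inter>n. rise k m z n)"
    using disj' by (intro plus_emeasure[symmetric]) auto
  also have "emeasure (law (Suc k)) (\<Union>n. fall k m z n) = (\<Sum>n. emeasure (law (Suc k)) (fall k m z n))"
    using disj fall_events by (intro suminf_emeasure[symmetric]) auto
  also have "(\<lambda>n. emeasure (law (Suc k)) (fall k m z n)) = (\<lambda>n. ennreal (prob (fall k m z n) * down a b (ups z n)))"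
  proof
    fix n
    show "emeasure (law (Suc k)) (fall k m z n) = ennreal (prob (fall k m z n) * down a b (ups z n))"
      using down_pos[OF ups_pos[OF z, of n]]
      by (subst emeasure_law_const[OF fall_events, where c="down a b (ups z n)"])
        (auto simp: value_at_def drop_time_fall mult.commute)
  qed
  also have "(\<Sum>n. ennreal (prob (fall k m z n) * down a b (ups z n))) = ennreal (prob (atom k m z) * z * (1 - keep_lim z))"
    using keep_sums down_pos[OF ups_pos[OF z]]
    by (intro sums_unique[symmetric]) (auto intro!: sums_ennreal[THEN iffD2] mult_nonneg_nonneg
        simp: less_imp_le keep_lim_bounds z)
  finally show ?thesis .
qed

lemma prob_Inter_rise: "(\<lambda>n. prob (rise k m z n)) \<longlonglongrightarrow> prob (\<Inter>n. rise k m z n)"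
  using rise_events by (intro finite_Lim_measure_decseq decseq_SucI) (auto simp: rise_Suc)

lemma law_atom: "emeasure (law k) (atom k m z) = ennreal (z * prob (atom k m z))"
  using z F_sets[OF atom_sets] by (intro emeasure_law_const) (auto simp: atom_def value_at_def)

text \<open>On the event of rising forever the new value is the limit \<open>L\<close> of the path,
  and this contributes exactly the fraction \<open>keep_lim z\<close> that the falls leave
  out.\<close>

lemma law_Suc_atom_bounded:
  assumes "bdd_above (range (ups z))"
  shows "emeasure (law (Suc k)) (atom k m z) = emeasure (law k) (atom k m z)"
proof -
  obtain L where L: "ups z \<longlonglongrightarrow> L"
    using LIMSEQ_incseq_SUP[OF assms] ups_mono[OF z] by (auto simp: incseq_def)
  have "L \<ge> 0" using LIMSEQ_le_const[OF L, of 0] ups_pos[OF z] by (auto intro: less_imp_le)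
  have "V (Suc k) \<omega> = L" if "\<omega> \<in> (\<Inter>n. rise k m z n)" for \<omega>
  proof -
    have r: "\<omega> \<in> rise k m z n" for n using that by auto
    then have k: "drop_time S k \<omega> = enat m" by (auto simp: rise_def atom_def)
    have "\<not> S j \<omega> < S (j - 1) \<omega>" if "m < j" for j
      using rise_no_drop[OF r that, of "j - m"] that by simp
    then have inf: "drop_time S (Suc k) \<omega> = \<infinity>"
      unfolding drop_time_Suc_eq_infinity_iff using k by auto
    have "(\<lambda>n. S (n + m) \<omega>) = ups z" using rise_value[OF r] by (auto simp: add.commute)
    then have "(\<lambda>n. S n \<omega>) \<longlonglongrightarrow> L"
      using L LIMSEQ_offset[of "\<lambda>n. S n \<omega>" m] by simp
    then show ?thesis
      unfolding inf by (simp add: value_at_def limit_value_def limI)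
  qed
  then have "emeasure (law (Suc k)) (\<Inter>n. rise k m z n) = ennreal (L * prob (\<Inter>n. rise k m z n))"
    using \<open>L \<ge> 0\<close> by (intro emeasure_law_const Inter_rise_events) auto
  \<comment> \<open>Both sides are limits of \<open>ups z n * prob (rise k m z n)\<close>: once
    factor by factor, once through \<open>ups_times_prob\<close>.\<close>
  moreover have "L * prob (\<Inter>n. rise k m z n) = prob (atom k m z) * z * keep_lim z"
  proof (rule LIMSEQ_unique)
    show "(\<lambda>n. ups z n * prob (rise k m z n)) \<longlonglongrightarrow> L * prob (\<Inter>n. rise k m z n)"
      by (intro tendsto_mult L prob_Inter_rise)
    have "ups z n * prob (rise k m z n) = prob (atom k m z) * z * keep z n" for n
      using ups_times_prob[OF z, of n] by (simp add: prob_rise algebra_simps)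
    then show "(\<lambda>n. ups z n * prob (rise k m z n)) \<longlonglongrightarrow> prob (atom k m z) * z * keep_lim z"
      by (simp add: tendsto_mult_left keep_tendsto z)
  qed
  ultimately have "emeasure (law (Suc k)) (atom k m z)
      = ennreal (prob (atom k m z) * z * (1 - keep_lim z)) + ennreal (prob (atom k m z) * z * keep_lim z)"
    by (simp only: law_Suc_atom)
  also have "\<dots> = ennreal (prob (atom k m z) * z * (1 - keep_lim z) + prob (atom k m z) * z * keep_lim z)"
    using z keep_lim_bounds[OF z] by (intro ennreal_plus[symmetric]) auto
  also have "\<dots> = emeasure (law k) (atom k m z)"
    by (simp add: law_atom algebra_simps)
  finally show ?thesis .
qed

text \<open>Since \<open>ups z n * prob (rise k m z n)\<close> is at most \<open>z\<close> while
  \<open>ups z n\<close> tends to infinity, rising forever has probability 0. The fraction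
  \<open>keep_lim z\<close> of the mass is lost.\<close>

lemma law_Suc_atom_unbounded:
  assumes "\<not> bdd_above (range (ups z))"
  shows "emeasure (law (Suc k)) (atom k m z) = ennreal (prob (atom k m z) * z * (1 - keep_lim z))"
proof -
  have "(\<lambda>n. prob (rise k m z n)) \<longlonglongrightarrow> 0"
  proof (rule tendsto_sandwich[of "\<lambda>_. 0"])
    have "prob (rise k m z n) \<le> z / ups z n" for n
    proof -
      have "ups z n * prob (rise k m z n) = z * (prob (atom k m z) * keep z n)"
        using ups_times_prob[OF z, of n] by (simp add: prob_rise algebra_simps)
      also have "\<dots> \<le> z * (1 * 1)"
        using z keep_pos[OF z, of n] keep_le_1[OF z, of n] by (intro mult_left_mono mult_mono) auto
      finally show ?thesis using ups_pos[OF z, of n] by (simp add: field_simps)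
    qed
    then show "\<forall>\<^sub>F n in sequentially. prob (rise k m z n) \<le> z / ups z n" by simp
    show "(\<lambda>n. z / ups z n) \<longlonglongrightarrow> 0"
      by (intro tendsto_divide_0[OF tendsto_const] filterlim_at_top_imp_at_infinity ups_at_top z assms)
  qed auto
  then have "prob (\<Inter>n. rise k m z n) = 0"
    using LIMSEQ_unique prob_Inter_rise by blast
  then have "(\<Inter>n. rise k m z n) \<in> null_sets M"
    using Inter_rise_events by (auto simp: null_sets_def emeasure_eq_measure)
  \<comment> \<open>Absolute continuity suffices here, so the value that \<open>lim\<close> takes on
    divergent paths does not enter.\<close>
  then have "emeasure (law (Suc k)) (\<Inter>n. rise k m z n) = 0"
    using absolutely_continuousI_density[of "\<lambda>\<omega>. ennreal (V (Suc k) \<omega>)" M]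
    unfolding absolutely_continuous_def law_def by auto
  then show ?thesis by (simp add: law_Suc_atom)
qed

lemma law_Suc_atom_le: "emeasure (law (Suc k)) (atom k m z) \<le> emeasure (law k) (atom k m z)"
proof (cases "bdd_above (range (ups z))")
  case False
  then show ?thesis
    using z keep_lim_bounds[OF z]
    by (auto simp: law_Suc_atom_unbounded law_atom mult.commute[of z] intro!: ennreal_leI mult_left_le)
qed (simp add: law_Suc_atom_bounded)

end

section \<open>Summation over all atoms\<close>

definition states :: "real set" where
  "states = (\<Union>n. layer x n)"

lemma countable_states: "countable states"
  unfolding states_def by (intro countable_UN) (auto intro: countable_finite finite_layer)

lemma states_pos: "z \<in> states \<Longrightarrow> z > 0"
  unfolding states_def using layer_pos[OF x_pos] by auto

lemma AE_atoms:
  "AE \<omega> in M. drop_time S k \<omega> = \<infinity> \<or> \<omega> \<in> (\<Union>(m, z)\<in>UNIV \<times> states. atom k m z)"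
  using AE_step AE_space
proof eventually_elim
  case (elim \<omega>)
  show ?case
  proof (cases "drop_time S k \<omega>")
    case (enat m)
    then have "\<omega> \<in> atom k m (S m \<omega>)" "S m \<omega> \<in> states"
      using elim by (auto simp: atom_def states_def)
    then show ?thesis by blast
  qed simp
qed

lemma atom_disjoint: "disjoint_family_on (\<lambda>(m, z). atom k m z) J"
  by (auto simp: disjoint_family_on_def atom_def)

lemma never_event: "{\<omega>\<in>space M. drop_time S k \<omega> = \<infinity>} \<in> sets M"
proof -
  have "{\<omega>\<in>space M. drop_time S k \<omega> = \<infinity>}
      = space M - (\<Union>n. {\<omega>\<in>space (F n). drop_time S k \<omega> = enat n})"
    by (auto simp: not_infinity_eq)
  moreover have "{\<omega>\<in>space (F n). drop_time S k \<omega> = enat n} \<in> sets M" for n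
    by (intro F_sets[of _ n] predE drop_time_pred) simp
  ultimately show ?thesis by auto
qed

text \<open>The index set \<open>J\<close> is a parameter so that a single atom can be left out when
  a strict loss is to be isolated.\<close>

definition cover :: "nat \<Rightarrow> (nat \<times> real) set \<Rightarrow> 'w set" where
  "cover k J = {\<omega>\<in>space M. drop_time S k \<omega> = \<infinity>} \<union> (\<Union>(m, z)\<in>J. atom k m z)"

lemma law_never: "emeasure (law (Suc k)) {\<omega>\<in>space M. drop_time S k \<omega> = \<infinity>}
  = emeasure (law k) {\<omega>\<in>space M. drop_time S k \<omega> = \<infinity>}"
proof -
  have "V (Suc k) \<omega> = V k \<omega>" if "drop_time S k \<omega> = \<infinity>" for \<omega>
  proof -
    have "drop_time S (Suc k) \<omega> = \<infinity>"
      unfolding drop_time_Suc_eq_infinity_iff using that by simp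
    with that show ?thesis by simp
  qed
  then show ?thesis
    unfolding law_def using never_event
    by (subst (1 2) emeasure_density) (auto intro!: nn_integral_cong simp: indicator_def)
qed

lemma atom_events: "atom k m z \<in> sets M"
  by (rule F_sets[OF atom_sets])

lemma cover_events:
  assumes "J \<subseteq> UNIV \<times> states" shows "cover k J \<in> sets M"
proof -
  have "countable J"
    using assms by (rule countable_subset) (intro countable_SIGMA countable_states countableI_type)
  then show ?thesis
    unfolding cover_def using never_event atom_events by (auto intro!: sets.Un sets.countable_UN')
qed

text \<open>The countable sum is written as an integral over a counting measure, so that atomwise
  comparisons carry over by monotonicity or congruence of integrals.\<close>

lemma emeasure_law_cover:
  assumes J: "J \<subseteq> UNIV \<times> states"
  shows "emeasure (law j) (cover k J) = emeasure (law j) {\<omega>\<in>space M. drop_time S k \<omega> = \<infinity>}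
    + (\<integral>\<^sup>+i. emeasure (law j) (case i of (m, z) \<Rightarrow> atom k m z) \<partial>count_space J)"
proof -
  have J': "countable J"
    using J by (rule countable_subset) (intro countable_SIGMA countable_states countableI_type)
  have ev: "(\<Union>(m, z)\<in>J. atom k m z) \<in> sets M"
    using J' atom_events by (auto intro!: sets.countable_UN')
  have "emeasure (law j) (cover k J) = emeasure (law j) {\<omega>\<in>space M. drop_time S k \<omega> = \<infinity>}
      + emeasure (law j) (\<Union>(m, z)\<in>J. atom k m z)"
    unfolding cover_def
  proof (rule plus_emeasure[symmetric])
    show "{\<omega>\<in>space M. drop_time S k \<omega> = \<infinity>} \<inter> (\<Union>(m, z)\<in>J. atom k m z) = {}"
      by (auto simp: atom_def)
  qed (simp_all only: sets_law never_event ev)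
  also have "emeasure (law j) (\<Union>(m, z)\<in>J. atom k m z)
      = (\<integral>\<^sup>+i. emeasure (law j) (case i of (m, z) \<Rightarrow> atom k m z) \<partial>count_space J)"
    using J' atom_events atom_disjoint by (intro emeasure_UN_countable) auto
  finally show ?thesis .
qed

lemma law_Suc_cover_le:
  assumes "J \<subseteq> UNIV \<times> states"
  shows "emeasure (law (Suc k)) (cover k J) \<le> emeasure (law k) (cover k J)"
  unfolding emeasure_law_cover[OF assms] law_never
  using assms states_pos by (intro add_left_mono nn_integral_mono) (auto intro!: law_Suc_atom_le)

lemma emeasure_law_total: "emeasure (law j) (space M) = emeasure (law j) (cover k (UNIV \<times> states))"
proof (rule emeasure_eq_AE)
  show "AE \<omega> in law j. \<omega> \<in> space M \<longleftrightarrow> \<omega> \<in> cover k (UNIV \<times> states)"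
    using AE_law[OF AE_atoms[of k]] by eventually_elim (auto simp: cover_def atom_def)
qed (simp_all add: cover_events)

lemma law_Suc_total_le: "emeasure (law (Suc k)) (space M) \<le> emeasure (law k) (space M)"
  unfolding emeasure_law_total[of _ k] by (rule law_Suc_cover_le) simp

text \<open>Under the assumption no atom loses mass: it is null, or its path converges, or the
  fraction that would be lost is 0.\<close>

lemma law_Suc_total_eq:
  assumes "\<And>m z. z > 0 \<Longrightarrow> prob (atom k m z) > 0 \<Longrightarrow> bdd_above (range (ups z)) \<or> keep_lim z = 0"
  shows "emeasure (law (Suc k)) (space M) = emeasure (law k) (space M)"
proof -
  have "emeasure (law (Suc k)) (atom k m z) = emeasure (law k) (atom k m z)" if z: "z > 0" for m z
  proof (cases "bdd_above (range (ups z))")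
    case False
    then have "prob (atom k m z) = 0 \<or> keep_lim z = 0"
      using assms[OF z, of m] by (metis measure_nonneg less_eq_real_def)
    with False show ?thesis
      by (auto simp: law_Suc_atom_unbounded[OF z] law_atom[OF z] mult.commute[of z])
  qed (simp add: law_Suc_atom_bounded[OF z])
  then have "emeasure (law (Suc k)) (cover k (UNIV \<times> states)) = emeasure (law k) (cover k (UNIV \<times> states))"
    unfolding emeasure_law_cover[OF subset_refl] law_never
    using states_pos by (intro arg_cong2[where f="(+)"] nn_integral_cong refl) auto
  then show ?thesis unfolding emeasure_law_total[of _ k] .
qed

lemma AE_S_0: "AE \<omega> in M. S 0 \<omega> = x"
  using AE_step by (auto elim!: eventually_mono dest: spec[of _ 0])

lemma law_0_total: "emeasure (law 0) (space M) = ennreal x"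
proof -
  have "emeasure (law 0) (space M) = (\<integral>\<^sup>+\<omega>. ennreal x \<partial>M)"
    unfolding emeasure_law_space using AE_S_0
    by (intro nn_integral_cong_AE) (auto simp: value_at_def zero_enat_def)
  then show ?thesis by (simp add: emeasure_space_1)
qed

lemma law_total_le: "emeasure (law k) (space M) \<le> ennreal x"
  by (induction k) (auto simp: law_0_total intro: order_trans law_Suc_total_le)

text \<open>One atom loses mass strictly, and no gain on the other atoms can compensate for
  it.\<close>

lemma law_Suc_total_less:
  assumes z: "z \<in> states" "prob (atom k m z) > 0" "\<not> bdd_above (range (ups z))" "keep_lim z > 0"
  shows "emeasure (law (Suc k)) (space M) < emeasure (law k) (space M)"
proof -
  let ?J = "UNIV \<times> states - {(m, z)}"
  have zp: "z > 0" by (rule states_pos[OF z(1)])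
  have J: "?J \<subseteq> UNIV \<times> states" by auto
  have split: "emeasure (law j) (space M) = emeasure (law j) (cover k ?J) + emeasure (law j) (atom k m z)" for j
  proof -
    have "cover k (UNIV \<times> states) = cover k ?J \<union> atom k m z"
      using z(1) by (auto simp: cover_def)
    moreover have "cover k ?J \<inter> atom k m z = {}"
      by (auto simp: cover_def atom_def)
    ultimately show ?thesis
      unfolding emeasure_law_total[of _ k] using cover_events[OF J] atom_events
      by (simp add: plus_emeasure)
  qed
  have "emeasure (law k) (cover k ?J) \<le> emeasure (law k) (space M)"
    unfolding split by simp
  also have "\<dots> \<le> ennreal x" by (rule law_total_le)
  \<comment> \<open>In \<open>ennreal\<close> a strict inequality survives adding a common summand
    only if that summand is finite.\<close>
  finally have fin: "emeasure (law k) (cover k ?J) \<noteq> top"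
    by (auto simp: top_unique)
  have "emeasure (law (Suc k)) (atom k m z) < emeasure (law k) (atom k m z)"
    unfolding law_Suc_atom_unbounded[OF zp z(3)] law_atom[OF zp]
    using zp z(2,4) keep_lim_bounds[OF zp]
    by (intro ennreal_lessI) (auto simp: mult.commute[of z])
  with fin have "emeasure (law k) (cover k ?J) + emeasure (law (Suc k)) (atom k m z)
      < emeasure (law k) (cover k ?J) + emeasure (law k) (atom k m z)"
    by (simp only: ennreal_add_left_cancel_less infinity_ennreal_def simp_thms)
  with add_right_mono[OF law_Suc_cover_le[OF J]] show ?thesis
    unfolding split by (rule le_less_trans)
qed

section \<open>Reachable states and boundedness\<close>

text \<open>A step up prolongs the current upward path, and a step down opens a new one of length 0
  at the next drop time. Thus every point of a layer lies on the upward path of an atom of positive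
  probability.\<close>

lemma layer_atom:
  "y \<in> layer x n \<Longrightarrow> \<exists>k m j z. z \<in> states \<and> prob (atom k m z) > 0 \<and> y = ups z j"
proof (induction n arbitrary: y)
  case 0
  have "AE \<omega> in M. \<omega> \<in> atom 0 0 x"
    using AE_S_0 AE_space by eventually_elim (auto simp: atom_def zero_enat_def)
  then have "prob (atom 0 0 x) = 1"
    using prob_eq_1[OF atom_events] by blast
  moreover have "x \<in> states" unfolding states_def by (auto intro: exI[of _ 0])
  ultimately have "x \<in> states \<and> prob (atom 0 0 x) > 0 \<and> y = ups x 0"
    using 0 by simp
  then show ?case by blast
next
  case (Suc n)
  then obtain y' where y': "y' \<in> layer x n" "y = up a b y' \<or> y = down a b y'" by auto
  obtain k m j z where kmjz: "z \<in> states" "prob (atom k m z) > 0" "y' = ups z j"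
    using Suc.IH[OF y'(1)] by blast
  from y'(2) show ?case
  proof
    assume "y = up a b y'"
    then have "y = ups z (Suc j)" by (simp add: ups_Suc kmjz)
    with kmjz show ?thesis by blast
  next
    assume y: "y = down a b y'"
    have zp: "z > 0" by (rule states_pos[OF kmjz(1)])
    have "fall k m z j \<subseteq> atom (Suc k) (Suc (m + j)) y"
    proof
      fix \<omega> assume \<omega>: "\<omega> \<in> fall k m z j"
      then show "\<omega> \<in> atom (Suc k) (Suc (m + j)) y"
        using drop_time_fall[OF zp \<omega>] y kmjz(3) by (auto simp: atom_def fall_def rise_def)
    qed
    then have "prob (fall k m z j) \<le> prob (atom (Suc k) (Suc (m + j)) y)"
      by (intro finite_measure_mono atom_events)
    moreover have "prob (fall k m z j) > 0"
      unfolding prob_fall[OF zp] using kmjz(2) ab[OF ups_pos[OF zp]]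
      by (intro mult_pos_pos prod_pos) (auto intro: less_trans)
    ultimately have "prob (atom (Suc k) (Suc (m + j)) y) > 0" by simp
    moreover have "y \<in> states" unfolding states_def using y y'(1) by (auto intro!: exI[of _ "Suc n"])
    ultimately have "y \<in> states \<and> prob (atom (Suc k) (Suc (m + j)) y) > 0 \<and> y = ups y 0" by simp
    then show ?thesis by blast
  qed
qed

text \<open>From an atom of positive probability every finite upward run has positive probability,
  so a deterministic bound on the chain also bounds the whole path.\<close>

lemma as_bounded_imp_bdd_above:
  assumes "as_bounded M S" and z: "z > 0" and pos: "prob (atom k m z) > 0"
  shows "bdd_above (range (ups z))"
proof -
  obtain C where C: "AE \<omega> in M. \<forall>n. S n \<omega> \<le> C"
    using assms(1) unfolding as_bounded_def by blast
  have "ups z n \<le> C" for n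
  proof (rule ccontr)
    assume "\<not> ups z n \<le> C"
    with C have "AE \<omega> in M. \<omega> \<notin> rise k m z n"
      by (auto elim!: eventually_mono dest!: rise_value[OF z] spec[of _ "m + n"])
    then have "prob (rise k m z n) = 0"
      using rise_events[OF z] by (simp add: prob_eq_0)
    moreover have "prob (rise k m z n) > 0"
      unfolding prob_rise[OF z] using pos ab[OF ups_pos[OF z]]
      by (intro mult_pos_pos prod_pos) auto
    ultimately show False by simp
  qed
  then show ?thesis by (rule bdd_aboveI2)
qed

text \<open>If all layers stayed below \<open>Y\<close>, the chain would be almost surely bounded by
  \<open>Y\<close>; hence some state above \<open>Y\<close> lies on the path of an atom.\<close>

lemma not_as_bounded_imp_atom:
  assumes "\<not> as_bounded M S"
  obtains k m j z where "z \<in> states" "prob (atom k m z) > 0" "Y \<le> ups z j"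
proof -
  have "\<exists>y\<in>states. Y \<le> y"
  proof (rule ccontr)
    assume "\<not> (\<exists>y\<in>states. Y \<le> y)"
    then have le: "y \<le> Y" if "y \<in> layer x n" for n y
      using that unfolding states_def by (meson UN_I UNIV_I nle_le)
    have "AE \<omega> in M. \<forall>n. S n \<omega> \<le> Y"
      using AE_step by eventually_elim (auto intro: le)
    with assms show False by (auto simp: as_bounded_def)
  qed
  then obtain n y where "y \<in> layer x n" "Y \<le> y" unfolding states_def by auto
  then show thesis using layer_atom[of y n] that by auto
qed

text \<open>At index 0 the mass is exactly \<open>x\<close>, so a strict loss can only appear at
  some \<open>k \<ge> 1\<close>.\<close>

lemma bubble_iff_law: "bubble M S \<longleftrightarrow> (\<exists>k. emeasure (law k) (space M) < ennreal x)"
proof -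
  have "(\<integral>\<^sup>+\<omega>. ennreal (S 0 \<omega>) \<partial>M) = (\<integral>\<^sup>+\<omega>. ennreal x \<partial>M)"
    using AE_S_0 by (intro nn_integral_cong_AE) auto
  then have "(\<integral>\<^sup>+\<omega>. ennreal (S 0 \<omega>) \<partial>M) = ennreal x"
    by (simp add: emeasure_space_1)
  moreover have "k \<ge> 1" if "emeasure (law k) (space M) < ennreal x" for k
    using that law_0_total by (cases k) auto
  ultimately show ?thesis
    unfolding bubble_def emeasure_law_space[symmetric] by auto
qed

end

theorem theorem2p9:
  fixes a b :: "real \<Rightarrow> real" and x\<^sub>b x :: real
    and M :: "'w measure" and S :: "nat \<Rightarrow> 'w \<Rightarrow> real"
  assumes "a \<in> borel_measurable pos_borel"
    and "b \<in> borel_measurable pos_borel"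
    and "\<And>y. y > 0 \<Longrightarrow> 0 < b y \<and> b y < a y \<and> a y < 1"
    and "0 < Liminf at_top (\<lambda>y. ereal (a y))"
    and "Limsup at_top (\<lambda>y. ereal (a y)) < 1"
    and "x\<^sub>b > 0"
    and "antimono_on {x\<^sub>b..} b"
    and "x > 0"
    and "markov_chain_from M pos_borel (two_point_kernel a b) x S"
  shows "bubble M S \<longleftrightarrow>
    \<not> as_bounded M S \<and> (\<integral>\<^sup>+u\<in>{ln x\<^sub>b..}. ennreal (b (exp u)) \<partial>lborel) < \<infinity>"
proof -
  interpret T: two_point_tail a b x\<^sub>b
    by unfold_locales (use assms in auto)
  interpret C: two_point_chain a b x M S
    by unfold_locales (use assms in auto)
  show ?thesis
  proof
    assume bub: "bubble M S"
    show "\<not> as_bounded M S \<and> T.b_integral < \<infinity>"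
    proof (rule ccontr)
      assume neg: "\<not> (\<not> as_bounded M S \<and> T.b_integral < \<infinity>)"
      \<comment> \<open>If boundedness or the integral condition fails the bubble criterion, no atom
        loses mass, so the expectation stays \<open>x\<close> at every drop time.\<close>
      have "bdd_above (range (T.ups z)) \<or> T.keep_lim z = 0"
        if z: "z > 0" and "C.prob (C.atom k m z) > 0" for k m z
      proof (cases "as_bounded M S")
        case True
        then show ?thesis using C.as_bounded_imp_bdd_above[OF True that] by blast
      next
        case False
        with neg have "\<not> T.b_integral < \<infinity>" by blast
        then show ?thesis
          using T.b_integral_finite[OF z] T.keep_lim_bounds(1)[OF z] by fastforce
      qed
      then have "emeasure (C.law k) (space M) = ennreal x" for k
        by (induction k) (simp_all add: C.law_0_total C.law_Suc_total_eq)
      with bub show False by (simp add: C.bubble_iff_law)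
    qed
  next
    assume *: "\<not> as_bounded M S \<and> T.b_integral < \<infinity>"
    obtain Y where explode: "\<And>z. z \<ge> Y \<Longrightarrow> \<not> bdd_above (range (T.ups z))"
      and keep: "\<And>z. z > 0 \<Longrightarrow> \<not> bdd_above (range (T.ups z)) \<Longrightarrow> T.keep_lim z > 0"
      using T.eventually_ups_explode * by metis
    \<comment> \<open>Explosion is known only for starting points beyond \<open>Y\<close>; an upward
      path that gets there inherits it, because its tail is the path from
      \<open>T.ups z j\<close>.\<close>
    obtain k m j z where z: "z \<in> C.states" "C.prob (C.atom k m z) > 0" "Y \<le> T.ups z j"
      using C.not_as_bounded_imp_atom * by metis
    have unb: "\<not> bdd_above (range (T.ups z))"
    proof
      assume "bdd_above (range (T.ups z))"
      then have "bdd_above (range (T.ups (T.ups z j)))"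
        by (rule bdd_above_mono) (auto simp flip: T.ups_add)
      with explode[OF z(3)] show False by blast
    qed
    have "emeasure (C.law (Suc k)) (space M) < emeasure (C.law k) (space M)"
      using C.law_Suc_total_less[OF z(1,2) unb] keep[OF C.states_pos[OF z(1)] unb] by blast
    also have "\<dots> \<le> ennreal x" by (rule C.law_total_le)
    finally show "bubble M S" unfolding C.bubble_iff_law by blast
  qed
qed

end
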